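(* Let $\mathcal A,\mathcal B$ be unital Banach algebras with units $1_{\mathcal A},1_{\mathcal B}$, let $\mathcal M$ be a unital Banach $\mathcal A$-$\mathcal B$-bimodule, let $\mathcal T=\mathrm{Tri}(\mathcal A,\mathcal M,\mathcal B)$, and let $\sigma,\tau:\mathcal T\to\mathcal T$ be two continuous idempotent homomorphisms with $\sigma(1_{\mathcal A}\oplus 0)=\tau(1_{\mathcal A}\oplus 0)=1_{\mathcal A}\oplus 0$ and $\sigma(0\oplus 1_{\mathcal B})=\tau(0\oplus 1_{\mathcal B})=0\oplus 1_{\mathcal B}$. If $\mathcal T$ is $(\sigma,\tau)$-amenable, then $\mathcal A$ and $\mathcal B$ are $(\sigma,\tau)$-amenable. Moreover, if $\mathcal T$ is $\sigma$-amenable, then $\sigma(\mathcal M)=\{0\}$.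
   Context: $\mathrm{Tri}(\mathcal A,\mathcal M,\mathcal B)$ is the algebra of matrices $\begin{bmatrix}a&m\\0&b\end{bmatrix}$ ($a\in\mathcal A$, $m\in\mathcal M$, $b\in\mathcal B$) with the usual matrix addition and multiplication and the norm $\|a\|+\|m\|+\|b\|$. A unital Banach $\mathcal A$-$\mathcal B$-bimodule satisfies $a(mb)=(am)b$ and $1_{\mathcal A}m=m1_{\mathcal B}=m$. Write $a\oplus b=\begin{bmatrix}a&0\\0&b\end{bmatrix}$; identify $a\in\mathcal A$ with $a\oplus 0$, $b\in\mathcal B$ with $0\oplus b$, and $m\in\mathcal M$ with $\begin{bmatrix}0&m\\0&0\end{bmatrix}$. A homomorphism $\sigma$ is idempotent if $\sigma\circ\sigma=\sigma$. The conditions on $\sigma,\tau$ imply $\sigma(\mathcal A)\subseteq\mathcal A$, $\sigma(\mathcal B)\subseteq\mathcal B$, $\sigma(\mathcal M)\subseteq\mathcal M$ and likewise for $\tau$; the restrictions of $\sigma,\tau$ to $\mathcal A$, $\mathcal B$ and $\mathcal M$ are denoted again by $\sigma,\tau$. For a Banach algebra $\mathcal C$, continuous homomorphisms $\sigma,\tau:\mathcal C\to\mathcal C$ and a Banach $\mathcal C$-bimodule $\mathcal E$: a $(\sigma,\tau)$-derivation is a linear map $d:\mathcal C\to\mathcal E$ with $d(ab)=d(a)\sigma(b)+\tau(a)d(b)$ for all $a,b\in\mathcal C$; it is $(\sigma,\tau)$-inner if there is $x\in\mathcal E$ with $d(a)=\tau(a)x-x\sigma(a)$ for all $a$. $\mathcal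 C$ is $(\sigma,\tau)$-amenable if for every Banach $\mathcal C$-bimodule $\mathcal E$ (not necessarily unital), every continuous $(\sigma,\tau)$-derivation from $\mathcal C$ into the dual bimodule $\mathcal E^*$ is $(\sigma,\tau)$-inner; here $(c\cdot f)(x)=f(x\cdot c)$, $(f\cdot c)(x)=f(c\cdot x)$ for $f\in\mathcal E^*$. $\sigma$-amenable means $(\sigma,\sigma)$-amenable. *)

theory Defs
  imports "HOL-Algebra.Module" "HOL-Analysis.Analysis"
begin

section \<open>Banach spaces, Banach algebras and Banach bimodules over the complex numbers\<close>

text \<open>
  Amenability quantifies over all Banach bimodules, so spaces are structures with an explicit
  carrier, extending the \<open>module\<close> record of HOL-Algebra by a norm. For a mere Banach space the
  inherited fields \<open>mult\<close> and \<open>one\<close> are irrelevant, as for modules in HOL-Algebra.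
\<close>

definition complex_ring :: "complex ring" where
  "complex_ring = \<lparr>carrier = UNIV, monoid.mult = (*), one = 1, zero = 0, add = (+)\<rparr>"

lemma complex_ring_simps [simp]:
  "carrier complex_ring = UNIV" "x \<otimes>\<^bsub>complex_ring\<^esub> y = x * y" "x \<oplus>\<^bsub>complex_ring\<^esub> y = x + y"
  "\<one>\<^bsub>complex_ring\<^esub> = 1" "\<zero>\<^bsub>complex_ring\<^esub> = 0"
  by (simp_all add: complex_ring_def)

lemma cring_complex_ring: "cring complex_ring"
proof (rule cringI)
  show "abelian_group complex_ring"
    by (rule abelian_groupI) (auto intro: exI[of _ "- _"] simp: add_eq_0_iff2)
  show "comm_monoid complex_ring"
    by (rule comm_monoidI) auto
qed (auto simp: ring_distribs)

record 'a normed_mod = "(complex, 'a) module" +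
  vnorm :: "'a \<Rightarrow> real"

text \<open>
  The locale \<^locale>\<open>Metric_space\<close> constrains the distance on the whole type, hence the value 0
  off the carrier.
\<close>

definition ndist :: "'a normed_mod \<Rightarrow> 'a \<Rightarrow> 'a \<Rightarrow> real" where
  "ndist E x y = (if x \<in> carrier E \<and> y \<in> carrier E then vnorm E (x \<ominus>\<^bsub>E\<^esub> y) else 0)"

abbreviation ntop :: "'a normed_mod \<Rightarrow> 'a topology" where
  "ntop E \<equiv> Metric_space.mtopology (carrier E) (ndist E)"

locale complex_normed_space = Module.module complex_ring E for E :: "'a normed_mod" (structure) +
  assumes vnorm_nonneg: "x \<in> carrier E \<Longrightarrow> 0 \<le> vnorm E x"
    and vnorm_eq_0_iff: "x \<in> carrier E \<Longrightarrow> vnorm E x = 0 \<longleftrightarrow> x = \<zero>"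
    and vnorm_add_le: "x \<in> carrier E \<Longrightarrow> y \<in> carrier E \<Longrightarrow> vnorm E (x \<oplus> y) \<le> vnorm E x + vnorm E y"
    and vnorm_smult: "x \<in> carrier E \<Longrightarrow> vnorm E (c \<odot> x) = cmod c * vnorm E x"

lemma (in complex_normed_space) vnorm_minus:
  assumes x: "x \<in> carrier E" shows "vnorm E (\<ominus> x) = vnorm E x"
proof -
  have "(-1 + 1::complex) \<odot> x = (-1) \<odot> x \<oplus> 1 \<odot> x"
    using smult_l_distr[of "-1" 1 x] x by simp
  then have "(-1) \<odot> x \<oplus> x = \<zero>"
    using smult_one[OF x] smult_l_null[OF x] by simp
  then have "\<ominus> x = (-1) \<odot> x" using x smult_closed[of "-1" x]
    by (simp add: M.minus_equality)
  then show ?thesis using vnorm_smult[OF x, of "-1"] by simp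
qed

lemma (in complex_normed_space) Metric_ndist: "Metric_space (carrier E) (ndist E)"
proof
  have mc: "x \<ominus> y \<in> carrier E" if "x \<in> carrier E" "y \<in> carrier E" for x y
    using that by (rule M.minus_closed)
  show "0 \<le> ndist E x y" for x y by (auto simp: ndist_def mc vnorm_nonneg)
  show "ndist E x y = ndist E y x" for x y
  proof (cases "x \<in> carrier E \<and> y \<in> carrier E")
    case True
    have "x \<ominus> y = \<ominus> (y \<ominus> x)" using True
      by (simp add: M.minus_eq M.minus_add M.a_ac)
    then show ?thesis using True vnorm_minus[OF mc, of y x] by (simp add: ndist_def)
  qed (auto simp: ndist_def)
  show "ndist E x y = 0 \<longleftrightarrow> x = y" if xy: "x \<in> carrier E" "y \<in> carrier E" for x y
  proof -
    have "x \<ominus> y = \<zero> \<longleftrightarrow> x = y"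
    proof
      assume "x \<ominus> y = \<zero>"
      then have "(x \<oplus> \<ominus> y) \<oplus> y = y" using xy by (simp add: M.minus_eq)
      then show "x = y" using xy by (simp add: M.a_assoc M.l_neg)
    qed (use xy in \<open>simp add: M.minus_eq M.r_neg\<close>)
    then show ?thesis using xy by (simp add: ndist_def vnorm_eq_0_iff mc)
  qed
  show "ndist E x z \<le> ndist E x y + ndist E y z"
    if "x \<in> carrier E" "y \<in> carrier E" "z \<in> carrier E" for x y z
  proof -
    have "(x \<ominus> y) \<oplus> (y \<ominus> z) = x \<oplus> ((\<ominus> y \<oplus> y) \<oplus> \<ominus> z)" using that
      by (simp add: M.minus_eq M.a_assoc del: M.l_neg M.r_neg)
    also have "\<dots> = x \<ominus> z" using that by (simp add: M.l_neg M.minus_eq)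
    finally show ?thesis using vnorm_add_le[OF mc mc, of x y y z] that by (simp add: ndist_def)
  qed
qed

locale complex_banach_space = complex_normed_space +
  assumes complete: "Metric_space.mcomplete (carrier E) (ndist E)"

locale complex_banach_algebra = complex_banach_space C for C :: "'c normed_mod" (structure) +
  assumes mult_closed: "x \<in> carrier C \<Longrightarrow> y \<in> carrier C \<Longrightarrow> x \<otimes> y \<in> carrier C"
    and mult_assoc: "x \<in> carrier C \<Longrightarrow> y \<in> carrier C \<Longrightarrow> z \<in> carrier C \<Longrightarrow>
      (x \<otimes> y) \<otimes> z = x \<otimes> (y \<otimes> z)"
    and mult_add_left: "x \<in> carrier C \<Longrightarrow> y \<in> carrier C \<Longrightarrow> z \<in> carrier C \<Longrightarrow>
      (x \<oplus> y) \<otimes> z = x \<otimes> z \<oplus> y \<otimes> z"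
    and mult_add_right: "x \<in> carrier C \<Longrightarrow> y \<in> carrier C \<Longrightarrow> z \<in> carrier C \<Longrightarrow>
      x \<otimes> (y \<oplus> z) = x \<otimes> y \<oplus> x \<otimes> z"
    and mult_smult_left: "x \<in> carrier C \<Longrightarrow> y \<in> carrier C \<Longrightarrow> (c \<odot> x) \<otimes> y = c \<odot> (x \<otimes> y)"
    and mult_smult_right: "x \<in> carrier C \<Longrightarrow> y \<in> carrier C \<Longrightarrow> x \<otimes> (c \<odot> y) = c \<odot> (x \<otimes> y)"
    and vnorm_mult_le: "x \<in> carrier C \<Longrightarrow> y \<in> carrier C \<Longrightarrow>
      vnorm C (x \<otimes> y) \<le> vnorm C x * vnorm C y"

text \<open>
  The unit is not required to have norm 1: the unit of a triangular algebra over two nonzero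
  algebras has norm at least 2.
\<close>

locale unital_complex_banach_algebra = complex_banach_algebra +
  assumes one_closed: "\<one> \<in> carrier C"
    and mult_one_left: "x \<in> carrier C \<Longrightarrow> \<one> \<otimes> x = x"
    and mult_one_right: "x \<in> carrier C \<Longrightarrow> x \<otimes> \<one> = x"

text \<open>
  \<open>l a m\<close> is the left action and \<open>r m b\<close> the right action. The actions are contractive. For the
  module \<open>M\<close> of a triangular algebra this is forced by submultiplicativity of the norm
  \<open>\<parallel>a\<parallel> + \<parallel>m\<parallel> + \<parallel>b\<parallel>\<close>; a bimodule whose actions are only jointly continuous has
  an equivalent norm making them contractive, and passing to it changes neither the continuity
  of derivations into the dual nor their being inner.
\<close>

locale banach_bimodule =
  A: complex_banach_algebra A + B: complex_banach_algebra B + M: complex_banach_space M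
  for A :: "'a normed_mod" and B :: "'b normed_mod" and M :: "'m normed_mod"
    and l :: "'a \<Rightarrow> 'm \<Rightarrow> 'm" and r :: "'m \<Rightarrow> 'b \<Rightarrow> 'm" +
  assumes l_closed: "a \<in> carrier A \<Longrightarrow> x \<in> carrier M \<Longrightarrow> l a x \<in> carrier M"
    and l_add_left: "a \<in> carrier A \<Longrightarrow> a' \<in> carrier A \<Longrightarrow> x \<in> carrier M \<Longrightarrow>
      l (a \<oplus>\<^bsub>A\<^esub> a') x = l a x \<oplus>\<^bsub>M\<^esub> l a' x"
    and l_add_right: "a \<in> carrier A \<Longrightarrow> x \<in> carrier M \<Longrightarrow> y \<in> carrier M \<Longrightarrow>
      l a (x \<oplus>\<^bsub>M\<^esub> y) = l a x \<oplus>\<^bsub>M\<^esub> l a y"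
    and l_smult_left: "a \<in> carrier A \<Longrightarrow> x \<in> carrier M \<Longrightarrow> l (c \<odot>\<^bsub>A\<^esub> a) x = c \<odot>\<^bsub>M\<^esub> l a x"
    and l_smult_right: "a \<in> carrier A \<Longrightarrow> x \<in> carrier M \<Longrightarrow> l a (c \<odot>\<^bsub>M\<^esub> x) = c \<odot>\<^bsub>M\<^esub> l a x"
    and l_mult: "a \<in> carrier A \<Longrightarrow> a' \<in> carrier A \<Longrightarrow> x \<in> carrier M \<Longrightarrow>
      l (a \<otimes>\<^bsub>A\<^esub> a') x = l a (l a' x)"
    and l_norm: "a \<in> carrier A \<Longrightarrow> x \<in> carrier M \<Longrightarrow> vnorm M (l a x) \<le> vnorm A a * vnorm M x"
    and r_closed: "b \<in> carrier B \<Longrightarrow> x \<in> carrier M \<Longrightarrow> r x b \<in> carrier M"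
    and r_add_left: "b \<in> carrier B \<Longrightarrow> x \<in> carrier M \<Longrightarrow> y \<in> carrier M \<Longrightarrow>
      r (x \<oplus>\<^bsub>M\<^esub> y) b = r x b \<oplus>\<^bsub>M\<^esub> r y b"
    and r_add_right: "b \<in> carrier B \<Longrightarrow> b' \<in> carrier B \<Longrightarrow> x \<in> carrier M \<Longrightarrow>
      r x (b \<oplus>\<^bsub>B\<^esub> b') = r x b \<oplus>\<^bsub>M\<^esub> r x b'"
    and r_smult_left: "b \<in> carrier B \<Longrightarrow> x \<in> carrier M \<Longrightarrow> r (c \<odot>\<^bsub>M\<^esub> x) b = c \<odot>\<^bsub>M\<^esub> r x b"
    and r_smult_right: "b \<in> carrier B \<Longrightarrow> x \<in> carrier M \<Longrightarrow> r x (c \<odot>\<^bsub>B\<^esub> b) = c \<odot>\<^bsub>M\<^esub> r x b"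
    and r_mult: "b \<in> carrier B \<Longrightarrow> b' \<in> carrier B \<Longrightarrow> x \<in> carrier M \<Longrightarrow>
      r x (b \<otimes>\<^bsub>B\<^esub> b') = r (r x b) b'"
    and r_norm: "b \<in> carrier B \<Longrightarrow> x \<in> carrier M \<Longrightarrow> vnorm M (r x b) \<le> vnorm M x * vnorm B b"
    and l_r: "a \<in> carrier A \<Longrightarrow> b \<in> carrier B \<Longrightarrow> x \<in> carrier M \<Longrightarrow> l a (r x b) = r (l a x) b"

locale unital_banach_bimodule =
  banach_bimodule A B M l r + A: unital_complex_banach_algebra A + B: unital_complex_banach_algebra B
  for A :: "'a normed_mod" and B :: "'b normed_mod" and M :: "'m normed_mod"
    and l :: "'a \<Rightarrow> 'm \<Rightarrow> 'm" and r :: "'m \<Rightarrow> 'b \<Rightarrow> 'm" +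
  assumes l_one: "x \<in> carrier M \<Longrightarrow> l \<one>\<^bsub>A\<^esub> x = x"
    and r_one: "x \<in> carrier M \<Longrightarrow> r x \<one>\<^bsub>B\<^esub> = x"


section \<open>Dual bimodules\<close>

text \<open>
  Functionals are extensional (\<open>undefined\<close> off the carrier), so that equality in the dual is
  equality of functions.
\<close>

definition dual :: "'e normed_mod \<Rightarrow> ('e \<Rightarrow> complex) normed_mod" where
  "dual E = \<lparr>carrier = {f \<in> extensional (carrier E).
        (\<forall>x\<in>carrier E. \<forall>y\<in>carrier E. f (x \<oplus>\<^bsub>E\<^esub> y) = f x + f y) \<and>
        (\<forall>c. \<forall>x\<in>carrier E. f (c \<odot>\<^bsub>E\<^esub> x) = c * f x) \<and>
        (\<exists>K. \<forall>x\<in>carrier E. cmod (f x) \<le> K * vnorm E x)},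
     monoid.mult = undefined, one = undefined,
     zero = (\<lambda>x\<in>carrier E. 0),
     add = (\<lambda>f g. \<lambda>x\<in>carrier E. f x + g x),
     module.smult = (\<lambda>c f. \<lambda>x\<in>carrier E. c * f x),
     vnorm = (\<lambda>f. SUP x\<in>{x \<in> carrier E. vnorm E x \<le> 1}. cmod (f x))\<rparr>"

text \<open>For a bimodule with actions \<open>l\<close>, \<open>r\<close>: \<open>(c \<cdot> f)(x) = f(x \<cdot> c)\<close> and \<open>(f \<cdot> c)(x) = f(c \<cdot> x)\<close>.\<close>

definition dual_l :: "'e normed_mod \<Rightarrow> ('e \<Rightarrow> 'c \<Rightarrow> 'e) \<Rightarrow> 'c \<Rightarrow> ('e \<Rightarrow> complex) \<Rightarrow> ('e \<Rightarrow> complex)" where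
  "dual_l E r c f = (\<lambda>x\<in>carrier E. f (r x c))"

definition dual_r :: "'e normed_mod \<Rightarrow> ('c \<Rightarrow> 'e \<Rightarrow> 'e) \<Rightarrow> ('e \<Rightarrow> complex) \<Rightarrow> 'c \<Rightarrow> ('e \<Rightarrow> complex)" where
  "dual_r E l f c = (\<lambda>x\<in>carrier E. f (l c x))"


section \<open>Derivations and amenability\<close>

definition linear_map :: "'a normed_mod \<Rightarrow> 'b normed_mod \<Rightarrow> ('a \<Rightarrow> 'b) \<Rightarrow> bool" where
  "linear_map E F f \<longleftrightarrow> f \<in> carrier E \<rightarrow> carrier F \<and>
     (\<forall>x\<in>carrier E. \<forall>y\<in>carrier E. f (x \<oplus>\<^bsub>E\<^esub> y) = f x \<oplus>\<^bsub>F\<^esub> f y) \<and>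
     (\<forall>c. \<forall>x\<in>carrier E. f (c \<odot>\<^bsub>E\<^esub> x) = c \<odot>\<^bsub>F\<^esub> f x)"

definition algebra_endo :: "'c normed_mod \<Rightarrow> ('c \<Rightarrow> 'c) \<Rightarrow> bool" where
  "algebra_endo C \<sigma> \<longleftrightarrow> linear_map C C \<sigma> \<and>
     (\<forall>x\<in>carrier C. \<forall>y\<in>carrier C. \<sigma> (x \<otimes>\<^bsub>C\<^esub> y) = \<sigma> x \<otimes>\<^bsub>C\<^esub> \<sigma> y)"

definition continuous_endo :: "'c normed_mod \<Rightarrow> ('c \<Rightarrow> 'c) \<Rightarrow> bool" where
  "continuous_endo C \<sigma> \<longleftrightarrow> algebra_endo C \<sigma> \<and> continuous_map (ntop C) (ntop C) \<sigma>"

definition idempotent_on :: "'c normed_mod \<Rightarrow> ('c \<Rightarrow> 'c) \<Rightarrow> bool" where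
  "idempotent_on C \<sigma> \<longleftrightarrow> (\<forall>x\<in>carrier C. \<sigma> (\<sigma> x) = \<sigma> x)"

definition derivation ::
  "'c normed_mod \<Rightarrow> 'f normed_mod \<Rightarrow> ('c \<Rightarrow> 'f \<Rightarrow> 'f) \<Rightarrow> ('f \<Rightarrow> 'c \<Rightarrow> 'f) \<Rightarrow>
   ('c \<Rightarrow> 'c) \<Rightarrow> ('c \<Rightarrow> 'c) \<Rightarrow> ('c \<Rightarrow> 'f) \<Rightarrow> bool" where
  "derivation C F l r \<sigma> \<tau> d \<longleftrightarrow> linear_map C F d \<and>
     (\<forall>a\<in>carrier C. \<forall>b\<in>carrier C. d (a \<otimes>\<^bsub>C\<^esub> b) = r (d a) (\<sigma> b) \<oplus>\<^bsub>F\<^esub> l (\<tau> a) (d b))"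

definition inner_derivation ::
  "'c normed_mod \<Rightarrow> 'f normed_mod \<Rightarrow> ('c \<Rightarrow> 'f \<Rightarrow> 'f) \<Rightarrow> ('f \<Rightarrow> 'c \<Rightarrow> 'f) \<Rightarrow>
   ('c \<Rightarrow> 'c) \<Rightarrow> ('c \<Rightarrow> 'c) \<Rightarrow> ('c \<Rightarrow> 'f) \<Rightarrow> bool" where
  "inner_derivation C F l r \<sigma> \<tau> d \<longleftrightarrow>
     (\<exists>x\<in>carrier F. \<forall>a\<in>carrier C. d a = l (\<tau> a) x \<ominus>\<^bsub>F\<^esub> r x (\<sigma> a))"

text \<open>
  HOL cannot quantify over types inside a formula, so the class of test bimodules is the class of
  all Banach bimodules whose carrier is a subset of a type \<open>'e\<close> that is a parameter of the notion.
  The mathematical property is \<open>amenable TYPE('e) C \<sigma> \<tau>\<close> for all types \<open>'e\<close>; hence an implication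
  between instances at the same arbitrary \<open>'e\<close> gives the implication between the properties, and a
  hypothesis at one specific \<open>'e\<close> is weaker than the property itself.
\<close>

definition amenable :: "'e itself \<Rightarrow> 'c normed_mod \<Rightarrow> ('c \<Rightarrow> 'c) \<Rightarrow> ('c \<Rightarrow> 'c) \<Rightarrow> bool" where
  "amenable _ C \<sigma> \<tau> \<longleftrightarrow>
     complex_banach_algebra C \<and> continuous_endo C \<sigma> \<and> continuous_endo C \<tau> \<and>
     (\<forall>(E :: 'e normed_mod) l r d.
        banach_bimodule C C E l r \<longrightarrow>
        derivation C (dual E) (dual_l E r) (dual_r E l) \<sigma> \<tau> d \<longrightarrow>
        continuous_map (ntop C) (ntop (dual E)) d \<longrightarrow>
        inner_derivation C (dual E) (dual_l E r) (dual_r E l) \<sigma> \<tau> d)"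


section \<open>Triangular Banach algebras\<close>

text \<open>The triple \<open>(a, m, b)\<close> stands for the matrix with rows \<open>(a, m)\<close> and \<open>(0, b)\<close>.\<close>

definition tri ::
  "'a normed_mod \<Rightarrow> 'm normed_mod \<Rightarrow> 'b normed_mod \<Rightarrow> ('a \<Rightarrow> 'm \<Rightarrow> 'm) \<Rightarrow> ('m \<Rightarrow> 'b \<Rightarrow> 'm) \<Rightarrow>
   ('a \<times> 'm \<times> 'b) normed_mod" where
  "tri A M B l r = \<lparr>carrier = carrier A \<times> carrier M \<times> carrier B,
     monoid.mult = (\<lambda>(a, m, b) (a', m', b'). (a \<otimes>\<^bsub>A\<^esub> a', l a m' \<oplus>\<^bsub>M\<^esub> r m b', b \<otimes>\<^bsub>B\<^esub> b')),
     one = (\<one>\<^bsub>A\<^esub>, \<zero>\<^bsub>M\<^esub>, \<one>\<^bsub>B\<^esub>),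
     zero = (\<zero>\<^bsub>A\<^esub>, \<zero>\<^bsub>M\<^esub>, \<zero>\<^bsub>B\<^esub>),
     add = (\<lambda>(a, m, b) (a', m', b'). (a \<oplus>\<^bsub>A\<^esub> a', m \<oplus>\<^bsub>M\<^esub> m', b \<oplus>\<^bsub>B\<^esub> b')),
     module.smult = (\<lambda>c (a, m, b). (c \<odot>\<^bsub>A\<^esub> a, c \<odot>\<^bsub>M\<^esub> m, c \<odot>\<^bsub>B\<^esub> b)),
     vnorm = (\<lambda>(a, m, b). vnorm A a + vnorm M m + vnorm B b)\<rparr>"

definition diag :: "'m normed_mod \<Rightarrow> 'a \<Rightarrow> 'b \<Rightarrow> 'a \<times> 'm \<times> 'b" where
  "diag M a b = (a, \<zero>\<^bsub>M\<^esub>, b)"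

definition corner :: "'a normed_mod \<Rightarrow> 'b normed_mod \<Rightarrow> 'm \<Rightarrow> 'a \<times> 'm \<times> 'b" where
  "corner A B m = (\<zero>\<^bsub>A\<^esub>, m, \<zero>\<^bsub>B\<^esub>)"

text \<open>
  The restrictions of an endomorphism of the triangular algebra to the two diagonal algebras,
  under the identifications of \<open>a\<close> with \<open>a \<oplus> 0\<close> and of \<open>b\<close> with \<open>0 \<oplus> b\<close>.
  Nothing is lost by the projections when the endomorphism preserves these subalgebras.
\<close>

definition restrict_A ::
  "'m normed_mod \<Rightarrow> 'b normed_mod \<Rightarrow> ('a \<times> 'm \<times> 'b \<Rightarrow> 'a \<times> 'm \<times> 'b) \<Rightarrow> 'a \<Rightarrow> 'a" where
  "restrict_A M B \<sigma> a = fst (\<sigma> (diag M a \<zero>\<^bsub>B\<^esub>))"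

definition restrict_B ::
  "'a normed_mod \<Rightarrow> 'm normed_mod \<Rightarrow> ('a \<times> 'm \<times> 'b \<Rightarrow> 'a \<times> 'm \<times> 'b) \<Rightarrow> 'b \<Rightarrow> 'b" where
  "restrict_B A M \<sigma> b = snd (snd (\<sigma> (diag M \<zero>\<^bsub>A\<^esub> b)))"

text \<open>
  The triangular algebra is a unital Banach algebra; in particular the first conjunct of
  \<^const>\<open>amenable\<close> is no extra hypothesis on it.
\<close>

lemma tri_simps [simp]:
  "carrier (tri A M B l r) = carrier A \<times> carrier M \<times> carrier B"
  "(a, m, b) \<otimes>\<^bsub>tri A M B l r\<^esub> (a', m', b') = (a \<otimes>\<^bsub>A\<^esub> a', l a m' \<oplus>\<^bsub>M\<^esub> r m b', b \<otimes>\<^bsub>B\<^esub> b')"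
  "\<one>\<^bsub>tri A M B l r\<^esub> = (\<one>\<^bsub>A\<^esub>, \<zero>\<^bsub>M\<^esub>, \<one>\<^bsub>B\<^esub>)"
  "\<zero>\<^bsub>tri A M B l r\<^esub> = (\<zero>\<^bsub>A\<^esub>, \<zero>\<^bsub>M\<^esub>, \<zero>\<^bsub>B\<^esub>)"
  "(a, m, b) \<oplus>\<^bsub>tri A M B l r\<^esub> (a', m', b') = (a \<oplus>\<^bsub>A\<^esub> a', m \<oplus>\<^bsub>M\<^esub> m', b \<oplus>\<^bsub>B\<^esub> b')"
  "c \<odot>\<^bsub>tri A M B l r\<^esub> (a, m, b) = (c \<odot>\<^bsub>A\<^esub> a, c \<odot>\<^bsub>M\<^esub> m, c \<odot>\<^bsub>B\<^esub> b)"
  "vnorm (tri A M B l r) (a, m, b) = vnorm A a + vnorm M m + vnorm B b"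
  by (simp_all add: tri_def)

context unital_banach_bimodule begin

abbreviation (input) "T \<equiv> tri A M B l r"

lemma abelian_group_T: "abelian_group T"
proof (rule abelian_groupI)
  fix x assume "x \<in> carrier T"
  then obtain a m b where x: "x = (a,m,b)" "a \<in> carrier A" "m \<in> carrier M" "b \<in> carrier B" by auto
  then have "(\<ominus>\<^bsub>A\<^esub> a, \<ominus>\<^bsub>M\<^esub> m, \<ominus>\<^bsub>B\<^esub> b) \<in> carrier T"
    "(\<ominus>\<^bsub>A\<^esub> a, \<ominus>\<^bsub>M\<^esub> m, \<ominus>\<^bsub>B\<^esub> b) \<oplus>\<^bsub>T\<^esub> x = \<zero>\<^bsub>T\<^esub>"
    by (auto simp: A.M.l_neg B.M.l_neg M.M.l_neg)
  then show "\<exists>y\<in>carrier T. y \<oplus>\<^bsub>T\<^esub> x = \<zero>\<^bsub>T\<^esub>" by blast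
qed (auto simp: A.M.a_ac B.M.a_ac M.M.a_ac)

lemma minus_T:
  assumes "a \<in> carrier A" "m \<in> carrier M" "b \<in> carrier B" "a' \<in> carrier A" "m' \<in> carrier M" "b' \<in> carrier B"
  shows "(a,m,b) \<ominus>\<^bsub>T\<^esub> (a',m',b') = (a \<ominus>\<^bsub>A\<^esub> a', m \<ominus>\<^bsub>M\<^esub> m', b \<ominus>\<^bsub>B\<^esub> b')"
proof -
  interpret T: abelian_group T by (rule abelian_group_T)
  have "\<ominus>\<^bsub>T\<^esub> (a',m',b') = (\<ominus>\<^bsub>A\<^esub> a', \<ominus>\<^bsub>M\<^esub> m', \<ominus>\<^bsub>B\<^esub> b')"
    using assms by (intro T.minus_equality) (auto simp: A.M.l_neg B.M.l_neg M.M.l_neg)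
  then show ?thesis by (simp add: a_minus_def)
qed

lemma module_T: "Module.module complex_ring T"
  by (rule Module.moduleI[OF cring_complex_ring abelian_group_T])
     (use A.smult_closed B.smult_closed M.smult_closed A.smult_l_distr B.smult_l_distr M.smult_l_distr
       A.smult_r_distr B.smult_r_distr M.smult_r_distr A.smult_assoc1 B.smult_assoc1 M.smult_assoc1
       A.smult_one B.smult_one M.smult_one in auto)

lemma normed_T: "complex_normed_space T"
proof (intro complex_normed_space.intro module_T complex_normed_space_axioms.intro)
  fix x y assume "x \<in> carrier T" "y \<in> carrier T"
  then obtain a m b a' m' b' where xy: "x = (a,m,b)" "a \<in> carrier A" "m \<in> carrier M" "b \<in> carrier B"
     "y = (a',m',b')" "a' \<in> carrier A" "m' \<in> carrier M" "b' \<in> carrier B" by auto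
  then show "vnorm T (x \<oplus>\<^bsub>T\<^esub> y) \<le> vnorm T x + vnorm T y"
    using A.vnorm_add_le[of a a'] M.vnorm_add_le[of m m'] B.vnorm_add_le[of b b'] by simp
next
  fix x assume "x \<in> carrier T"
  then obtain a m b where x: "x = (a,m,b)" "a \<in> carrier A" "m \<in> carrier M" "b \<in> carrier B" by auto
  note n = A.vnorm_nonneg[OF x(2)] M.vnorm_nonneg[OF x(3)] B.vnorm_nonneg[OF x(4)]
  show "0 \<le> vnorm T x" using x n by simp
  show "(vnorm T x = 0) = (x = \<zero>\<^bsub>T\<^esub>)" using x n A.vnorm_eq_0_iff M.vnorm_eq_0_iff B.vnorm_eq_0_iff
    by (auto simp: add_nonneg_eq_0_iff)
  show "vnorm T (c \<odot>\<^bsub>T\<^esub> x) = cmod c * vnorm T x" for c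
    using x A.vnorm_smult M.vnorm_smult B.vnorm_smult by (simp add: algebra_simps)
qed

lemma ndist_T: "x \<in> carrier T \<Longrightarrow> y \<in> carrier T \<Longrightarrow> ndist T x y =
   ndist A (fst x) (fst y) + ndist M (fst (snd x)) (fst (snd y)) + ndist B (snd (snd x)) (snd (snd y))"
  by (cases x; cases y) (auto simp: ndist_def minus_T)

lemma banach_T: "complex_banach_space T"
proof (intro complex_banach_space.intro normed_T complex_banach_space_axioms.intro)
  interpret mT: Metric_space "carrier T" "ndist T"
    using complex_normed_space.Metric_ndist[OF normed_T] .
  interpret mA: Metric_space "carrier A" "ndist A" by (rule A.Metric_ndist)
  interpret mB: Metric_space "carrier B" "ndist B" by (rule B.Metric_ndist)
  interpret mM: Metric_space "carrier M" "ndist M" by (rule M.Metric_ndist)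
  show "mT.mcomplete" unfolding mT.mcomplete_def
  proof (intro allI impI)
    fix s :: "nat \<Rightarrow> 'a \<times> 'm \<times> 'b" assume s: "mT.MCauchy s"
    then have sc: "s n \<in> carrier T" for n unfolding mT.MCauchy_def by blast
    have c: "fst (s n) \<in> carrier A" "fst (snd (s n)) \<in> carrier M" "snd (snd (s n)) \<in> carrier B" for n
      using sc[of n] by auto
    have cauchy: "\<exists>N. \<forall>n n'. N \<le> n \<longrightarrow> N \<le> n' \<longrightarrow> ndist A (fst (s n)) (fst (s n')) < e \<and>
       ndist M (fst (snd (s n))) (fst (snd (s n'))) < e \<and>  ndist B (snd (snd (s n))) (snd (snd (s n'))) < e"
      if "e > 0" for e
    proof -
      have "\<exists>N. \<forall>n n'. N \<le> n \<longrightarrow> N \<le> n' \<longrightarrow> ndist T (s n) (s n') < e"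
        using s \<open>e > 0\<close> unfolding mT.MCauchy_def by (elim conjE allE[of _ e] impE)
      then obtain N where N: "\<And>n n'. N \<le> n \<Longrightarrow> N \<le> n' \<Longrightarrow> ndist T (s n) (s n') < e"
        by meson
      show ?thesis
      proof (intro exI[of _ N] allI impI)
        fix n n' assume "N \<le> n" "N \<le> n'"
        from N[OF this] show "ndist A (fst (s n)) (fst (s n')) < e \<and>
          ndist M (fst (snd (s n))) (fst (snd (s n'))) < e \<and>  ndist B (snd (snd (s n))) (snd (snd (s n'))) < e"
          unfolding ndist_T[OF sc sc]
          using mA.nonneg[of "fst (s n)" "fst (s n')"] mM.nonneg[of "fst (snd (s n))" "fst (snd (s n'))"]
            mB.nonneg[of "snd (snd (s n))" "snd (snd (s n'))"] by linarith
      qed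
    qed
    have "mA.MCauchy (\<lambda>n. fst (s n))"
      unfolding mA.MCauchy_def
    proof (intro conjI allI impI)
      show "range (\<lambda>n. fst (s n)) \<subseteq> carrier A" using c(1) by blast
      show "\<exists>N. \<forall>n n'. N \<le> n \<longrightarrow> N \<le> n' \<longrightarrow> ndist A (fst (s n)) (fst (s n')) < e" if "e > 0" for e
        using cauchy[OF that] by meson
    qed
    then obtain a where a: "limitin mA.mtopology (\<lambda>n. fst (s n)) a sequentially"
      using A.complete unfolding mA.mcomplete_def by fast
    have "mM.MCauchy (\<lambda>n. fst (snd (s n)))"
      unfolding mM.MCauchy_def
    proof (intro conjI allI impI)
      show "range (\<lambda>n. fst (snd (s n))) \<subseteq> carrier M" using c(2) by blast
      show "\<exists>N. \<forall>n n'. N \<le> n \<longrightarrow> N \<le> n' \<longrightarrow> ndist M (fst (snd (s n))) (fst (snd (s n'))) < e" if "e > 0" for e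
        using cauchy[OF that] by meson
    qed
    then obtain m where m: "limitin mM.mtopology (\<lambda>n. fst (snd (s n))) m sequentially"
      using M.complete unfolding mM.mcomplete_def by fast
    have "mB.MCauchy (\<lambda>n. snd (snd (s n)))"
      unfolding mB.MCauchy_def
    proof (intro conjI allI impI)
      show "range (\<lambda>n. snd (snd (s n))) \<subseteq> carrier B" using c(3) by blast
      show "\<exists>N. \<forall>n n'. N \<le> n \<longrightarrow> N \<le> n' \<longrightarrow> ndist B (snd (snd (s n))) (snd (snd (s n'))) < e" if "e > 0" for e
        using cauchy[OF that] by meson
    qed
    then obtain b where b: "limitin mB.mtopology (\<lambda>n. snd (snd (s n))) b sequentially"
      using B.complete unfolding mB.mcomplete_def by fast
    have abm: "a \<in> carrier A" "m \<in> carrier M" "b \<in> carrier B"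
      using a m b mA.limitin_mspace mM.limitin_mspace mB.limitin_mspace by blast+
    have "limitin mT.mtopology s (a,m,b) sequentially"
      unfolding mT.limit_metric_sequentially
    proof (intro conjI allI impI)
      show abmT: "(a,m,b) \<in> carrier T" using abm by simp
      fix e :: real assume "e > 0"
      then have e3: "e/3 > 0" by simp
      obtain N1 where N1: "\<And>n. N1 \<le> n \<Longrightarrow> ndist A (fst (s n)) a < e/3"
        using a e3 unfolding mA.limit_metric_sequentially by blast
      obtain N2 where N2: "\<And>n. N2 \<le> n \<Longrightarrow> ndist M (fst (snd (s n))) m < e/3"
        using m e3 unfolding mM.limit_metric_sequentially by blast
      obtain N3 where N3: "\<And>n. N3 \<le> n \<Longrightarrow> ndist B (snd (snd (s n))) b < e/3"
        using b e3 unfolding mB.limit_metric_sequentially by blast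
      have "s n \<in> carrier T \<and> ndist T (s n) (a,m,b) < e" if "n \<ge> max N1 (max N2 N3)" for n
      proof
        show "s n \<in> carrier T" by (rule sc)
        have "ndist A (fst (s n)) a < e/3" "ndist M (fst (snd (s n))) m < e/3"
          "ndist B (snd (snd (s n))) b < e/3"
          using that N1 N2 N3 by auto
        then show "ndist T (s n) (a,m,b) < e"
          unfolding ndist_T[OF sc abmT] fst_conv snd_conv by linarith
      qed
      then show "\<exists>N. \<forall>n\<ge>N. s n \<in> carrier T \<and> ndist T (s n) (a,m,b) < e" by blast
    qed
    then show "\<exists>x. limitin mT.mtopology s x sequentially" by blast
  qed
qed

lemma l_zero: "a \<in> carrier A \<Longrightarrow> l a \<zero>\<^bsub>M\<^esub> = \<zero>\<^bsub>M\<^esub>"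
  using l_add_right[of a "\<zero>\<^bsub>M\<^esub>" "\<zero>\<^bsub>M\<^esub>"] l_closed[of a "\<zero>\<^bsub>M\<^esub>"] by simp
lemma r_zero: "b \<in> carrier B \<Longrightarrow> r \<zero>\<^bsub>M\<^esub> b = \<zero>\<^bsub>M\<^esub>"
  using r_add_left[of b "\<zero>\<^bsub>M\<^esub>" "\<zero>\<^bsub>M\<^esub>"] r_closed[of b "\<zero>\<^bsub>M\<^esub>"] by simp

lemma tri_unital_banach_algebra: "unital_complex_banach_algebra T"
proof (intro unital_complex_banach_algebra.intro complex_banach_algebra.intro banach_T
    complex_banach_algebra_axioms.intro unital_complex_banach_algebra_axioms.intro)
  note closed = A.mult_closed B.mult_closed l_closed r_closed A.one_closed B.one_closed
  show "x \<otimes>\<^bsub>T\<^esub> y \<in> carrier T" if "x \<in> carrier T" "y \<in> carrier T" for x y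
    using that by (auto simp: closed)
  show "(x \<otimes>\<^bsub>T\<^esub> y) \<otimes>\<^bsub>T\<^esub> z = x \<otimes>\<^bsub>T\<^esub> (y \<otimes>\<^bsub>T\<^esub> z)"
    if "x \<in> carrier T" "y \<in> carrier T" "z \<in> carrier T" for x y z
    using that by (auto simp: closed A.mult_assoc B.mult_assoc l_mult r_mult l_add_right r_add_left l_r M.M.a_ac)
  show "(x \<oplus>\<^bsub>T\<^esub> y) \<otimes>\<^bsub>T\<^esub> z = x \<otimes>\<^bsub>T\<^esub> z \<oplus>\<^bsub>T\<^esub> y \<otimes>\<^bsub>T\<^esub> z"
    "x \<otimes>\<^bsub>T\<^esub> (y \<oplus>\<^bsub>T\<^esub> z) = x \<otimes>\<^bsub>T\<^esub> y \<oplus>\<^bsub>T\<^esub> x \<otimes>\<^bsub>T\<^esub> z"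
    if "x \<in> carrier T" "y \<in> carrier T" "z \<in> carrier T" for x y z
    using that by (auto simp: closed A.mult_add_left B.mult_add_left A.mult_add_right B.mult_add_right
        l_add_left r_add_left l_add_right r_add_right M.M.a_ac)
  show "(c \<odot>\<^bsub>T\<^esub> x) \<otimes>\<^bsub>T\<^esub> y = c \<odot>\<^bsub>T\<^esub> (x \<otimes>\<^bsub>T\<^esub> y)" "x \<otimes>\<^bsub>T\<^esub> (c \<odot>\<^bsub>T\<^esub> y) = c \<odot>\<^bsub>T\<^esub> (x \<otimes>\<^bsub>T\<^esub> y)"
    if "x \<in> carrier T" "y \<in> carrier T" for x y c
    using that by (auto simp: closed A.mult_smult_left B.mult_smult_left A.mult_smult_right B.mult_smult_right
        l_smult_left l_smult_right r_smult_left r_smult_right M.smult_r_distr)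
  show "\<one>\<^bsub>T\<^esub> \<in> carrier T" by (simp add: closed)
  show "\<one>\<^bsub>T\<^esub> \<otimes>\<^bsub>T\<^esub> x = x" "x \<otimes>\<^bsub>T\<^esub> \<one>\<^bsub>T\<^esub> = x" if "x \<in> carrier T" for x
    using that by (auto simp: A.mult_one_left B.mult_one_left A.mult_one_right B.mult_one_right
        l_one r_one l_zero r_zero)
  show "vnorm T (x \<otimes>\<^bsub>T\<^esub> y) \<le> vnorm T x * vnorm T y" if "x \<in> carrier T" "y \<in> carrier T" for x y
  proof -
    obtain a m b a' m' b' where xy: "x = (a,m,b)" "a \<in> carrier A" "m \<in> carrier M" "b \<in> carrier B"
     "y = (a',m',b')" "a' \<in> carrier A" "m' \<in> carrier M" "b' \<in> carrier B"
      using \<open>x \<in> carrier T\<close> \<open>y \<in> carrier T\<close> by (cases x; cases y) auto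
    note n = A.vnorm_nonneg[OF xy(2)] M.vnorm_nonneg[OF xy(3)] B.vnorm_nonneg[OF xy(4)]
      A.vnorm_nonneg[OF xy(6)] M.vnorm_nonneg[OF xy(7)] B.vnorm_nonneg[OF xy(8)]
    have "vnorm M (l a m' \<oplus>\<^bsub>M\<^esub> r m b') \<le> vnorm A a * vnorm M m' + vnorm M m * vnorm B b'"
      using M.vnorm_add_le[of "l a m'" "r m b'"] l_norm[of a m'] r_norm[of b' m] closed xy by fastforce
    moreover have "vnorm A (a \<otimes>\<^bsub>A\<^esub> a') \<le> vnorm A a * vnorm A a'" using A.vnorm_mult_le xy by blast
    moreover have "vnorm B (b \<otimes>\<^bsub>B\<^esub> b') \<le> vnorm B b * vnorm B b'" using B.vnorm_mult_le xy by blast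
    moreover have "0 \<le> vnorm A a * vnorm B b'" "0 \<le> vnorm M m * vnorm A a'" "0 \<le> vnorm M m * vnorm M m'"
      "0 \<le> vnorm B b * vnorm A a'" "0 \<le> vnorm B b * vnorm M m'" using n by auto
    ultimately have "vnorm A (a \<otimes>\<^bsub>A\<^esub> a') + vnorm M (l a m' \<oplus>\<^bsub>M\<^esub> r m b') + vnorm B (b \<otimes>\<^bsub>B\<^esub> b') \<le>
      (vnorm A a * vnorm A a' + vnorm A a * vnorm M m' + vnorm A a * vnorm B b') +
      (vnorm M m * vnorm A a' + vnorm M m * vnorm M m' + vnorm M m * vnorm B b') +
      (vnorm B b * vnorm A a' + vnorm B b * vnorm M m' + vnorm B b * vnorm B b')"
      by linarith
    also have "\<dots> = (vnorm A a + vnorm M m + vnorm B b) * (vnorm A a' + vnorm M m' + vnorm B b')"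
      by (simp only: distrib_left distrib_right add_ac)
    finally show ?thesis unfolding xy tri_simps .
  qed
qed

end

end

theory Submission
  imports Defs
begin

text \<open>
  Write \<open>T\<close> for the triangular algebra and \<open>e\<close>, \<open>f\<close> for its diagonal idempotents \<open>1 \<oplus> 0\<close> and
  \<open>0 \<oplus> 1\<close>. The three corners of a matrix \<open>t\<close> are \<open>e t e\<close>, \<open>e t f\<close> and \<open>f t f\<close>, so an
  endomorphism that fixes \<open>e\<close> and \<open>f\<close> acts on each corner separately (\<open>endo_components\<close>).

  Consequently the two projections of \<open>T\<close> onto the diagonal algebras are contractive surjective
  homomorphisms that intertwine \<open>\<sigma>\<close> and \<open>\<tau>\<close> with their restrictions, and amenability passes to
  such quotients: a bimodule over the quotient is a bimodule over \<open>T\<close>, a derivation of the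
  quotient composed with the projection is a derivation of \<open>T\<close>, and a functional that implements
  the latter implements the former (\<open>amenable_quotient\<close>). The underlying space of the test
  bimodule does not change.

  For the corner, the assignment of \<open>\<sigma> m\<close> to the matrix \<open>(a, m, b)\<close> is a \<open>(\<sigma>, \<sigma>)\<close>-derivation of
  \<open>T\<close> into \<open>M\<close>, on which \<open>T\<close> acts from the left by its \<open>A\<close>-component and from the right by its
  \<open>B\<close>-component. Composition with the canonical embedding \<open>M \<rightarrow> M\<^sup>*\<^sup>*\<close> gives a continuous
  derivation into the dual of the \<open>T\<close>-bimodule \<open>M\<^sup>*\<close>. If it is inner, its value at a corner element
  \<open>t\<close> is \<open>\<sigma>(t) F - F \<sigma>(t)\<close> for some \<open>F\<close>. Here \<open>\<sigma>(t)\<close> lies in the corner as well, its diagonal is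
  zero, and so both terms vanish. Hence \<open>\<sigma> m\<close> is zero in the bidual, and
  it is zero in \<open>M\<close> because bounded functionals separate points (\<open>corner_map_zero\<close>).

  Two pieces of functional analysis are needed for spaces with an explicit carrier: the dual is
  a Banach space (\<open>dual_banach\<close>), and every nonzero vector has a bounded functional that is
  nonzero on it (\<open>functional_nonzero\<close>).
\<close>

section \<open>Bounded linear maps\<close>

context complex_normed_space begin

lemma neg_one_smult: "x \<in> carrier E \<Longrightarrow> (- 1) \<odot> x = \<ominus> x"
proof -
  assume x: "x \<in> carrier E"
  have "(- 1) \<odot> x \<oplus> x = ((- 1) + 1 :: complex) \<odot> x"
    using x smult_l_distr[of "- 1" 1 x] smult_one by simp
  also have "\<dots> = \<zero>" using smult_l_null[OF x] by simp
  finally show ?thesis using x by (simp add: M.minus_equality)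
qed

lemma vnorm_zero: "vnorm E \<zero> = 0"
  by (simp add: vnorm_eq_0_iff)

lemma minus_eq_smult: "x \<in> carrier E \<Longrightarrow> y \<in> carrier E \<Longrightarrow> x \<ominus> y = x \<oplus> (- 1) \<odot> y"
  by (simp add: a_minus_def neg_one_smult)

end

lemma linear_map_diff:
  assumes "complex_normed_space E" "complex_normed_space F" and f: "linear_map E F f"
    and xy: "x \<in> carrier E" "y \<in> carrier E"
  shows "f (x \<ominus>\<^bsub>E\<^esub> y) = f x \<ominus>\<^bsub>F\<^esub> f y"
proof -
  interpret E: complex_normed_space E by fact
  interpret F: complex_normed_space F by fact
  have "f x \<in> carrier F" "f y \<in> carrier F" using f xy by (auto simp: linear_map_def)
  then show ?thesis
    using f xy by (simp add: linear_map_def E.minus_eq_smult F.minus_eq_smult E.smult_closed)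
qed

lemma linear_map_comp:
  "linear_map E F f \<Longrightarrow> linear_map F G g \<Longrightarrow> linear_map E G (\<lambda>x. g (f x))"
  by (auto simp: linear_map_def Pi_iff)

lemma bounded_linear_map_continuous:
  assumes "complex_normed_space E" "complex_normed_space F" and f: "linear_map E F f"
    and K: "\<And>x. x \<in> carrier E \<Longrightarrow> vnorm F (f x) \<le> K * vnorm E x"
  shows "continuous_map (ntop E) (ntop F) f"
proof -
  interpret E: complex_normed_space E by fact
  interpret F: complex_normed_space F by fact
  interpret mE: Metric_space "carrier E" "ndist E" by (rule E.Metric_ndist)
  interpret mF: Metric_space "carrier F" "ndist F" by (rule F.Metric_ndist)
  have fc: "f x \<in> carrier F" if "x \<in> carrier E" for x using f that by (auto simp: linear_map_def)
  have lip: "ndist F (f a) (f x) \<le> (\<bar>K\<bar> + 1) * ndist E a x"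
    if "a \<in> carrier E" "x \<in> carrier E" for a x
  proof -
    have ax: "a \<ominus>\<^bsub>E\<^esub> x \<in> carrier E" using that by simp
    have "ndist F (f a) (f x) = vnorm F (f (a \<ominus>\<^bsub>E\<^esub> x))"
      using that fc by (simp add: ndist_def linear_map_diff[OF assms(1-3)])
    also have "\<dots> \<le> K * vnorm E (a \<ominus>\<^bsub>E\<^esub> x)" by (rule K[OF ax])
    also have "\<dots> \<le> (\<bar>K\<bar> + 1) * vnorm E (a \<ominus>\<^bsub>E\<^esub> x)"
      by (intro mult_right_mono E.vnorm_nonneg[OF ax]) auto
    finally show ?thesis using that by (simp add: ndist_def)
  qed
  have K1: "\<bar>K\<bar> + 1 > 0" by linarith
  show ?thesis unfolding mE.metric_continuous_map[OF F.Metric_ndist]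
  proof (intro conjI ballI allI impI)
    show "f ` carrier E \<subseteq> carrier F" using fc by blast
    fix a and e :: real assume a: "a \<in> carrier E" and e: "e > 0"
    have "ndist F (f a) (f x) < e" if "x \<in> carrier E \<and> ndist E a x < e / (\<bar>K\<bar> + 1)" for x
      using lip[of a x] that a K1 by (simp add: pos_less_divide_eq mult.commute)
    then show "\<exists>\<delta>>0. \<forall>x. x \<in> carrier E \<and> ndist E a x < \<delta> \<longrightarrow> ndist F (f a) (f x) < e"
      using e K1 by (intro exI[of _ "e / (\<bar>K\<bar> + 1)"]) auto
  qed
qed


section \<open>The dual of a normed space is a Banach space\<close>

lemma dualI:
  assumes "f \<in> extensional (carrier E)"
    and "\<And>x y. x \<in> carrier E \<Longrightarrow> y \<in> carrier E \<Longrightarrow> f (x \<oplus>\<^bsub>E\<^esub> y) = f x + f y"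
    and "\<And>c x. x \<in> carrier E \<Longrightarrow> f (c \<odot>\<^bsub>E\<^esub> x) = c * f x"
    and "\<And>x. x \<in> carrier E \<Longrightarrow> cmod (f x) \<le> K * vnorm E x"
  shows "f \<in> carrier (dual E)"
  using assms by (auto simp: dual_def intro!: exI[of _ K])

lemma dualD:
  assumes "f \<in> carrier (dual E)"
  shows "f \<in> extensional (carrier E)"
    and "x \<in> carrier E \<Longrightarrow> y \<in> carrier E \<Longrightarrow> f (x \<oplus>\<^bsub>E\<^esub> y) = f x + f y"
    and "x \<in> carrier E \<Longrightarrow> f (c \<odot>\<^bsub>E\<^esub> x) = c * f x"
    and "\<exists>K. \<forall>x\<in>carrier E. cmod (f x) \<le> K * vnorm E x"
  using assms by (auto simp: dual_def)

lemma dual_eqI: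
  assumes "f \<in> carrier (dual E)" "g \<in> carrier (dual E)" "\<And>x. x \<in> carrier E \<Longrightarrow> f x = g x"
  shows "f = g"
  using assms by (intro extensionalityI[of f "carrier E" g] dualD(1)) auto

lemma dual_simps:
  "f \<oplus>\<^bsub>dual E\<^esub> g = (\<lambda>x\<in>carrier E. f x + g x)"
  "c \<odot>\<^bsub>dual E\<^esub> f = (\<lambda>x\<in>carrier E. c * f x)"
  "\<zero>\<^bsub>dual E\<^esub> = (\<lambda>x\<in>carrier E. 0)"
  "vnorm (dual E) f = (SUP x\<in>{x \<in> carrier E. vnorm E x \<le> 1}. cmod (f x))"
  by (simp_all add: dual_def)

context complex_normed_space begin

lemma dual_zero_closed: "\<zero>\<^bsub>dual E\<^esub> \<in> carrier (dual E)"
  by (rule dualI[where K = 0]) (simp_all add: dual_simps)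

lemma dual_add_closed:
  assumes f: "f \<in> carrier (dual E)" and g: "g \<in> carrier (dual E)"
  shows "f \<oplus>\<^bsub>dual E\<^esub> g \<in> carrier (dual E)"
proof -
  obtain K L where K: "\<forall>x\<in>carrier E. cmod (f x) \<le> K * vnorm E x"
    and L: "\<forall>x\<in>carrier E. cmod (g x) \<le> L * vnorm E x"
    using dualD(4)[OF f] dualD(4)[OF g] by blast
  have "cmod (f x + g x) \<le> (K + L) * vnorm E x" if "x \<in> carrier E" for x
    using norm_triangle_ineq[of "f x" "g x"] K L that by (fastforce simp: distrib_right)
  then show ?thesis
    by (intro dualI[where K = "K + L"])
      (simp_all add: dual_simps dualD(2,3)[OF f] dualD(2,3)[OF g] algebra_simps)
qed

lemma dual_smult_closed:
  assumes f: "f \<in> carrier (dual E)" shows "c \<odot>\<^bsub>dual E\<^esub> f \<in> carrier (dual E)"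
proof -
  obtain K where K: "\<forall>x\<in>carrier E. cmod (f x) \<le> K * vnorm E x"
    using dualD(4)[OF f] by blast
  have "cmod (c * f x) \<le> (cmod c * K) * vnorm E x" if "x \<in> carrier E" for x
    using K that mult_left_mono[of "cmod (f x)" "K * vnorm E x" "cmod c"] by (simp add: norm_mult mult.assoc)
  then show ?thesis
    by (intro dualI[where K = "cmod c * K"])
      (simp_all add: dual_simps dualD(2,3)[OF f] algebra_simps)
qed

lemma dual_module: "Module.module complex_ring (dual E)"
proof (rule Module.moduleI[OF cring_complex_ring])
  show "abelian_group (dual E)"
  proof (rule abelian_groupI)
    fix f assume f: "f \<in> carrier (dual E)"
    show "\<zero>\<^bsub>dual E\<^esub> \<oplus>\<^bsub>dual E\<^esub> f = f"
      by (rule dual_eqI[OF dual_add_closed[OF dual_zero_closed f] f]) (simp add: dual_simps)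
    show "\<exists>g\<in>carrier (dual E). g \<oplus>\<^bsub>dual E\<^esub> f = \<zero>\<^bsub>dual E\<^esub>"
      by (rule bexI[OF _ dual_smult_closed[OF f, of "- 1"]]) (auto simp: dual_simps)
  qed (auto simp: dual_add_closed dual_zero_closed, auto simp: dual_simps algebra_simps)
qed (auto simp: dual_smult_closed, auto simp: dual_simps algebra_simps dest: dualD(1) intro!: restrict_ext extensional_restrict)

lemma dual_vnorm_bdd:
  assumes f: "f \<in> carrier (dual E)"
  shows "bdd_above ((\<lambda>x. cmod (f x)) ` {x \<in> carrier E. vnorm E x \<le> 1})"
proof -
  obtain K where K: "\<forall>x\<in>carrier E. cmod (f x) \<le> K * vnorm E x"
    using dualD(4)[OF f] by blast
  have "cmod (f x) \<le> \<bar>K\<bar>" if x: "x \<in> carrier E" "vnorm E x \<le> 1" for x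
  proof -
    have "cmod (f x) \<le> K * vnorm E x" using K x by blast
    also have "\<dots> \<le> \<bar>K\<bar> * 1" using x vnorm_nonneg[OF x(1)] by (intro mult_mono) auto
    finally show ?thesis by simp
  qed
  then show ?thesis by (intro bdd_aboveI2[of _ _ "\<bar>K\<bar>"]) auto
qed

lemma dual_vnorm_nonneg:
  assumes f: "f \<in> carrier (dual E)" shows "0 \<le> vnorm (dual E) f"
proof -
  have "0 \<le> cmod (f \<zero>)" by simp
  also have "\<dots> \<le> vnorm (dual E) f"
    unfolding dual_simps by (rule cSUP_upper[OF _ dual_vnorm_bdd[OF f]]) (simp add: vnorm_zero)
  finally show ?thesis .
qed

lemma dual_apply_le:
  assumes f: "f \<in> carrier (dual E)" and x: "x \<in> carrier E"
  shows "cmod (f x) \<le> vnorm (dual E) f * vnorm E x"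
proof (cases "vnorm E x = 0")
  case True
  then show ?thesis using dualD(4)[OF f] x by force
next
  case False
  then have pos: "vnorm E x > 0" using vnorm_nonneg[OF x] by linarith
  let ?c = "complex_of_real (1 / vnorm E x)"
  have "cmod (f (?c \<odot> x)) \<le> vnorm (dual E) f"
    unfolding dual_simps
    by (rule cSUP_upper[OF _ dual_vnorm_bdd[OF f]]) (use x pos in \<open>simp add: vnorm_smult norm_divide\<close>)
  then show ?thesis
    using pos dualD(3)[OF f x, of ?c] by (simp add: norm_mult norm_divide divide_le_eq)
qed

lemma dual_vnorm_le:
  assumes K: "K \<ge> 0" and f: "\<And>x. x \<in> carrier E \<Longrightarrow> cmod (f x) \<le> K * vnorm E x"
  shows "vnorm (dual E) f \<le> K"
  unfolding dual_simps
proof (rule cSUP_least)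
  show "{x \<in> carrier E. vnorm E x \<le> 1} \<noteq> {}" using vnorm_zero by force
  fix x assume "x \<in> {x \<in> carrier E. vnorm E x \<le> 1}"
  then have x: "x \<in> carrier E" "vnorm E x \<le> 1" by auto
  have "K * vnorm E x \<le> K * 1" using K x by (intro mult_left_mono) auto
  then show "cmod (f x) \<le> K" using f[OF x(1)] by linarith
qed

lemma dual_normed: "complex_normed_space (dual E)"
proof (intro complex_normed_space.intro dual_module complex_normed_space_axioms.intro)
  fix f g assume f: "f \<in> carrier (dual E)" and g: "g \<in> carrier (dual E)"
  show "vnorm (dual E) (f \<oplus>\<^bsub>dual E\<^esub> g) \<le> vnorm (dual E) f + vnorm (dual E) g"
  proof (rule dual_vnorm_le)
    fix x assume x: "x \<in> carrier E"
    show "cmod ((f \<oplus>\<^bsub>dual E\<^esub> g) x) \<le> (vnorm (dual E) f + vnorm (dual E) g) * vnorm E x"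
      using norm_triangle_ineq[of "f x" "g x"] dual_apply_le[OF f x] dual_apply_le[OF g x] x
      by (simp add: dual_simps(1) distrib_right)
  qed (use dual_vnorm_nonneg f g in fastforce)
next
  fix f assume f: "f \<in> carrier (dual E)"
  show "0 \<le> vnorm (dual E) f" by (rule dual_vnorm_nonneg[OF f])
  show "vnorm (dual E) f = 0 \<longleftrightarrow> f = \<zero>\<^bsub>dual E\<^esub>"
  proof
    assume "vnorm (dual E) f = 0"
    then have "f x = 0" if "x \<in> carrier E" for x using dual_apply_le[OF f that] by simp
    then show "f = \<zero>\<^bsub>dual E\<^esub>"
      by (intro dual_eqI[OF f dual_zero_closed]) (simp add: dual_simps(3))
  next
    assume "f = \<zero>\<^bsub>dual E\<^esub>"
    then have "vnorm (dual E) f \<le> 0" by (intro dual_vnorm_le) (auto simp: dual_simps(3))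
    then show "vnorm (dual E) f = 0" using dual_vnorm_nonneg[OF f] by linarith
  qed
  fix c
  have le: "vnorm (dual E) (c \<odot>\<^bsub>dual E\<^esub> g) \<le> cmod c * vnorm (dual E) g"
    if g: "g \<in> carrier (dual E)" for c g
  proof (rule dual_vnorm_le)
    fix x assume x: "x \<in> carrier E"
    show "cmod ((c \<odot>\<^bsub>dual E\<^esub> g) x) \<le> cmod c * vnorm (dual E) g * vnorm E x"
      using mult_left_mono[OF dual_apply_le[OF g x], of "cmod c"] x
      by (simp add: dual_simps(2) norm_mult mult.assoc)
  qed (use dual_vnorm_nonneg g in fastforce)
  show "vnorm (dual E) (c \<odot>\<^bsub>dual E\<^esub> f) = cmod c * vnorm (dual E) f"
  proof (cases "c = 0")
    case True
    then have "vnorm (dual E) (c \<odot>\<^bsub>dual E\<^esub> f) \<le> 0"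
      by (intro dual_vnorm_le) (auto simp: dual_simps(2))
    then show ?thesis using dual_vnorm_nonneg[OF dual_smult_closed[OF f, of c]] True by simp
  next
    case False
    have "(1 / c) \<odot>\<^bsub>dual E\<^esub> (c \<odot>\<^bsub>dual E\<^esub> f) = f"
      by (rule dual_eqI[OF dual_smult_closed[OF dual_smult_closed[OF f]] f])
        (simp add: dual_simps(2) False)
    then have "vnorm (dual E) f \<le> cmod (1 / c) * vnorm (dual E) (c \<odot>\<^bsub>dual E\<^esub> f)"
      using le[OF dual_smult_closed[OF f, of c], of "1 / c"] by simp
    then have "cmod c * vnorm (dual E) f \<le> vnorm (dual E) (c \<odot>\<^bsub>dual E\<^esub> f)"
      using False by (simp add: norm_divide field_simps)
    then show ?thesis using le[OF f, of c] by linarith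
  qed
qed

lemma dual_minus_apply:
  assumes f: "f \<in> carrier (dual E)" and g: "g \<in> carrier (dual E)" and x: "x \<in> carrier E"
  shows "(f \<ominus>\<^bsub>dual E\<^esub> g) x = f x - g x"
proof -
  interpret D: complex_normed_space "dual E" by (rule dual_normed)
  show ?thesis using D.minus_eq_smult[OF f g] x by (simp add: dual_simps(1,2))
qed

text \<open>
  A Cauchy sequence of functionals converges pointwise. Letting one index tend to infinity in the
  Cauchy estimate bounds the distance to the limit uniformly on the unit ball.
\<close>

lemma dual_banach: "complex_banach_space (dual E)"
proof (intro complex_banach_space.intro dual_normed complex_banach_space_axioms.intro)
  interpret D: complex_normed_space "dual E" by (rule dual_normed)
  interpret mD: Metric_space "carrier (dual E)" "ndist (dual E)" by (rule D.Metric_ndist)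
  show "mD.mcomplete" unfolding mD.mcomplete_def
  proof (intro allI impI)
    fix s assume s: "mD.MCauchy s"
    then have sc: "s n \<in> carrier (dual E)" for n unfolding mD.MCauchy_def by blast
    have diff: "cmod (s n x - s k x) \<le> ndist (dual E) (s n) (s k) * vnorm E x"
      if x: "x \<in> carrier E" for n k x
      using dual_apply_le[OF D.M.minus_closed[OF sc[of n] sc[of k]] x] sc x
      by (simp add: ndist_def dual_minus_apply)
    have cauchy: "\<exists>N. \<forall>n\<ge>N. \<forall>k\<ge>N. ndist (dual E) (s n) (s k) < e" if "e > 0" for e
      using s that unfolding mD.MCauchy_def by meson
    have "convergent (\<lambda>n. s n x)" if x: "x \<in> carrier E" for x
    proof (rule Cauchy_convergent, rule metric_CauchyI)
      fix e :: real assume e: "e > 0"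
      have v: "vnorm E x \<ge> 0" using x by (rule vnorm_nonneg)
      \<comment> \<open>The summand 1 only keeps the denominator positive at the zero vector.\<close>
      obtain N where N: "\<forall>n\<ge>N. \<forall>k\<ge>N. ndist (dual E) (s n) (s k) < e / (vnorm E x + 1)"
        using cauchy[of "e / (vnorm E x + 1)"] e v by auto
      have "dist (s n x) (s k x) < e" if "n \<ge> N" "k \<ge> N" for n k
      proof -
        have nd: "ndist (dual E) (s n) (s k) < e / (vnorm E x + 1)" using N that by blast
        have "dist (s n x) (s k x) \<le> ndist (dual E) (s n) (s k) * (vnorm E x + 1)"
          using diff[OF x, of n k] by (simp add: dist_norm distrib_left add_increasing2)
        also have "\<dots> < e" using nd v by (simp add: pos_less_divide_eq)
        finally show ?thesis .
      qed
      then show "\<exists>M. \<forall>m\<ge>M. \<forall>n\<ge>M. dist (s m x) (s n x) < e" by blast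
    qed
    then have lim: "(\<lambda>n. s n x) \<longlonglongrightarrow> lim (\<lambda>n. s n x)" if "x \<in> carrier E" for x
      using that convergent_LIMSEQ_iff by blast
    define g where "g = (\<lambda>x\<in>carrier E. lim (\<lambda>n. s n x))"
    have g: "(\<lambda>n. s n x) \<longlonglongrightarrow> g x" if "x \<in> carrier E" for x
      using lim[OF that] that by (simp add: g_def)
    have close: "\<exists>N. \<forall>n\<ge>N. \<forall>x\<in>carrier E. cmod (s n x - g x) \<le> e * vnorm E x" if e: "e > 0" for e
    proof -
      obtain N where N: "\<forall>n\<ge>N. \<forall>k\<ge>N. ndist (dual E) (s n) (s k) < e" using cauchy[OF e] by blast
      have "cmod (s n x - g x) \<le> e * vnorm E x" if n: "n \<ge> N" and x: "x \<in> carrier E" for n x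
      proof (rule tendsto_upperbound)
        show "(\<lambda>k. cmod (s n x - s k x)) \<longlonglongrightarrow> cmod (s n x - g x)"
          by (intro tendsto_intros g[OF x])
        have "cmod (s n x - s k x) \<le> e * vnorm E x" if k: "k \<ge> N" for k
        proof -
          have "ndist (dual E) (s n) (s k) \<le> e" using N n k by (simp add: less_imp_le)
          then show ?thesis
            using diff[OF x, of n k] mult_right_mono[of "ndist (dual E) (s n) (s k)" e "vnorm E x"]
              vnorm_nonneg[OF x] by linarith
        qed
        then show "\<forall>\<^sub>F k in sequentially. cmod (s n x - s k x) \<le> e * vnorm E x"
          unfolding eventually_sequentially by blast
      qed simp
      then show ?thesis by blast
    qed
    have gD: "g \<in> carrier (dual E)"
    proof -
      obtain N where N: "\<forall>n\<ge>N. \<forall>x\<in>carrier E. cmod (s n x - g x) \<le> 1 * vnorm E x"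
        using close[of 1] by auto
      show ?thesis
      proof (rule dualI)
        show "g \<in> extensional (carrier E)" by (simp add: g_def)
        show "g (x \<oplus> y) = g x + g y" if "x \<in> carrier E" "y \<in> carrier E" for x y
          using g[of "x \<oplus> y"] tendsto_add[OF g[OF that(1)] g[OF that(2)]] that dualD(2)[OF sc that]
            LIMSEQ_unique by simp
        show "g (c \<odot> x) = c * g x" if "x \<in> carrier E" for c x
          using g[of "c \<odot> x"] tendsto_mult_left[OF g[OF that], of c] that dualD(3)[OF sc that]
            LIMSEQ_unique by simp
        show "cmod (g x) \<le> (vnorm (dual E) (s N) + 1) * vnorm E x" if x: "x \<in> carrier E" for x
        proof -
          have "cmod (s N x - g x) \<le> vnorm E x" using N x by force
          then show ?thesis
            using dual_apply_le[OF sc[of N] x] norm_triangle_ineq2[of "g x" "s N x"]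
            by (simp add: distrib_right norm_minus_commute)
        qed
      qed
    qed
    have "limitin mD.mtopology s g sequentially"
      unfolding mD.limit_metric_sequentially
    proof (intro conjI allI impI gD)
      fix e :: real assume e: "e > 0"
      obtain N where N: "\<forall>n\<ge>N. \<forall>x\<in>carrier E. cmod (s n x - g x) \<le> (e / 2) * vnorm E x"
        using close[of "e / 2"] e by auto
      have "ndist (dual E) (s n) g < e" if n: "n \<ge> N" for n
      proof -
        have "vnorm (dual E) (s n \<ominus>\<^bsub>dual E\<^esub> g) \<le> e / 2"
          using N n e by (intro dual_vnorm_le) (auto simp: dual_minus_apply[OF sc gD])
        then show ?thesis using e sc gD by (simp add: ndist_def)
      qed
      then show "\<exists>N. \<forall>n\<ge>N. s n \<in> carrier (dual E) \<and> ndist (dual E) (s n) g < e" using sc by blast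
    qed
    then show "\<exists>g. limitin mD.mtopology s g sequentially" by blast
  qed
qed

end


section \<open>Enough bounded functionals: the Hahn--Banach theorem\<close>

context complex_normed_space begin

text \<open>
  Homogeneity is only demanded as an inequality and for positive scalars, because this is what
  passes to infima; equality follows by rescaling with the inverse.
\<close>

definition sublinear :: "('a \<Rightarrow> real) \<Rightarrow> bool" where
  "sublinear q \<longleftrightarrow> (\<forall>x\<in>carrier E. \<forall>y\<in>carrier E. q (x \<oplus> y) \<le> q x + q y) \<and>
     (\<forall>t>0. \<forall>x\<in>carrier E. q (complex_of_real t \<odot> x) \<le> t * q x)"

lemma sublinear_add: "sublinear q \<Longrightarrow> x \<in> carrier E \<Longrightarrow> y \<in> carrier E \<Longrightarrow> q (x \<oplus> y) \<le> q x + q y"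
  by (simp add: sublinear_def)

lemma sublinear_scale:
  assumes q: "sublinear q" and t: "t > 0" and x: "x \<in> carrier E"
  shows "q (complex_of_real t \<odot> x) = t * q x"
proof (rule antisym)
  show "q (complex_of_real t \<odot> x) \<le> t * q x" using assms by (simp add: sublinear_def)
  have "q (complex_of_real s \<odot> z) \<le> s * q z" if "s > 0" "z \<in> carrier E" for s z
    using q that by (simp add: sublinear_def)
  from this[of "1/t" "complex_of_real t \<odot> x"]
  have "q (complex_of_real (1/t) \<odot> (complex_of_real t \<odot> x)) \<le> (1/t) * q (complex_of_real t \<odot> x)"
    using t x smult_closed by simp
  moreover have "complex_of_real (1/t) \<odot> (complex_of_real t \<odot> x) = x"
    using smult_assoc1[of "complex_of_real (1/t)" "complex_of_real t" x] t x by (simp add: smult_one[simplified])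
  ultimately show "t * q x \<le> q (complex_of_real t \<odot> x)"
    using t by (simp add: field_simps)
qed

lemma sublinear_zero: "sublinear q \<Longrightarrow> q \<zero> = 0"
  using sublinear_scale[of q 2 \<zero>] smult_r_null[of "complex_of_real 2"] by simp

lemma sublinear_neg:
  assumes "sublinear q" "x \<in> carrier E" shows "- q (\<ominus> x) \<le> q x"
  using sublinear_add[OF assms(1,2), of "\<ominus> x"] assms sublinear_zero[of q] by (simp add: M.r_neg)

text \<open>
  Both infima needed below, over a chain and over translates, satisfy the hypotheses
  of this lemma.
\<close>

lemma sublinear_INF:
  assumes I: "I \<noteq> {}"
    and lower: "\<And>x i. x \<in> carrier E \<Longrightarrow> i \<in> I \<Longrightarrow> b x \<le> p i x"
    and add: "\<And>i j x y. i \<in> I \<Longrightarrow> j \<in> I \<Longrightarrow> x \<in> carrier E \<Longrightarrow> y \<in> carrier E \<Longrightarrow>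
      \<exists>k\<in>I. p k (x \<oplus> y) \<le> p i x + p j y"
    and scale: "\<And>i t x. i \<in> I \<Longrightarrow> t > 0 \<Longrightarrow> x \<in> carrier E \<Longrightarrow>
      \<exists>k\<in>I. p k (complex_of_real t \<odot> x) \<le> t * p i x"
  shows "sublinear (\<lambda>x\<in>carrier E. INF i\<in>I. p i x)"
    and "\<And>x i. x \<in> carrier E \<Longrightarrow> i \<in> I \<Longrightarrow> (\<lambda>x\<in>carrier E. INF i\<in>I. p i x) x \<le> p i x"
proof -
  let ?u = "\<lambda>x. INF i\<in>I. p i x"
  have bdd: "bdd_below ((\<lambda>i. p i x) ` I)" if "x \<in> carrier E" for x
    using lower[OF that] by (intro bdd_belowI2[of _ "b x"]) auto
  have le: "?u x \<le> p i x" if "x \<in> carrier E" "i \<in> I" for x i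
    using that by (intro cINF_lower bdd)
  then show "\<And>x i. x \<in> carrier E \<Longrightarrow> i \<in> I \<Longrightarrow> (\<lambda>x\<in>carrier E. INF i\<in>I. p i x) x \<le> p i x"
    by simp
  have "?u (x \<oplus> y) \<le> ?u x + ?u y" if xy: "x \<in> carrier E" "y \<in> carrier E" for x y
  proof -
    have sum: "?u (x \<oplus> y) \<le> p i x + p j y" if ij: "i \<in> I" "j \<in> I" for i j
    proof -
      obtain k where "k \<in> I" "p k (x \<oplus> y) \<le> p i x + p j y" using add[OF ij xy] by blast
      then show ?thesis using le[of "x \<oplus> y" k] xy by simp
    qed
    have "?u (x \<oplus> y) - ?u y \<le> p i x" if i: "i \<in> I" for i
    proof -
      have "?u (x \<oplus> y) - p i x \<le> p j y" if "j \<in> I" for j using sum[OF i that] by linarith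
      then have "?u (x \<oplus> y) - p i x \<le> ?u y" by (rule cINF_greatest[OF I])
      then show ?thesis by linarith
    qed
    then have "?u (x \<oplus> y) - ?u y \<le> ?u x" by (rule cINF_greatest[OF I])
    then show ?thesis by simp
  qed
  moreover have "?u (complex_of_real t \<odot> x) \<le> t * ?u x" if t: "t > 0" and x: "x \<in> carrier E" for t x
  proof -
    have "?u (complex_of_real t \<odot> x) / t \<le> p i x" if i: "i \<in> I" for i
    proof -
      obtain k where "k \<in> I" "p k (complex_of_real t \<odot> x) \<le> t * p i x" using scale[OF i t x] by blast
      then have "?u (complex_of_real t \<odot> x) \<le> t * p i x"
        using le[of "complex_of_real t \<odot> x" k] x by (simp add: smult_closed)
      then show ?thesis using t by (simp add: divide_le_eq mult.commute)
    qed
    then have "?u (complex_of_real t \<odot> x) / t \<le> ?u x" by (rule cINF_greatest[OF I])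
    then show ?thesis using t by (simp add: divide_le_eq mult.commute)
  qed
  ultimately show "sublinear (\<lambda>x\<in>carrier E. INF i\<in>I. p i x)"
    by (simp add: sublinear_def smult_closed)
qed

text \<open>
  This is the step that pushes a sublinear functional towards additivity at \<open>y\<close>. The witness sends
  \<open>x\<close> to the infimum over \<open>t \<ge> 0\<close> of \<open>q (x + t y) - t q y\<close>; the two upper bounds are
  the values at \<open>t = 0\<close> and \<open>t = 1\<close>, and taking all \<open>t \<ge> 0\<close> makes the infimum sublinear.
\<close>

lemma sublinear_below_translate:
  assumes q: "sublinear q" and y: "y \<in> carrier E"
  shows "\<exists>q'\<in>extensional (carrier E). sublinear q' \<and>
    (\<forall>x\<in>carrier E. q' x \<le> q x \<and> q' x \<le> q (x \<oplus> y) - q y)"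
proof -
  define p where "p t x = q (x \<oplus> complex_of_real t \<odot> y) - t * q y" for t x
  have ty: "complex_of_real t \<odot> y \<in> carrier E" for t using y by (simp add: smult_closed)
  have qty: "q (complex_of_real t \<odot> y) = t * q y" if "t \<ge> 0" for t
    using sublinear_scale[OF q _ y, of t] sublinear_zero[OF q] smult_l_null[OF y] that
    by (cases "t = 0") auto
  \<comment> \<open>Subadditivity applied to \<open>t y = - x + (x + t y)\<close> keeps the infimum finite.\<close>
  have lower: "- q (\<ominus> x) \<le> p t x" if x: "x \<in> carrier E" and t: "t \<in> {0..}" for x t
  proof -
    have "complex_of_real t \<odot> y = \<ominus> x \<oplus> (x \<oplus> complex_of_real t \<odot> y)"
      using x ty[of t] by (simp add: M.a_assoc[symmetric] M.l_neg)
    then have "q (complex_of_real t \<odot> y) \<le> q (\<ominus> x) + q (x \<oplus> complex_of_real t \<odot> y)"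
      using sublinear_add[OF q, of "\<ominus> x" "x \<oplus> complex_of_real t \<odot> y"] x ty[of t] by simp
    then show ?thesis using qty[of t] t by (simp add: p_def)
  qed
  have add: "\<exists>k\<in>{0..}. p k (x \<oplus> x') \<le> p s x + p t x'"
    if st: "s \<in> {0..}" "t \<in> {0..}" and x: "x \<in> carrier E" "x' \<in> carrier E" for s t x x'
  proof
    have "complex_of_real (s + t) \<odot> y = complex_of_real s \<odot> y \<oplus> complex_of_real t \<odot> y"
      using y smult_l_distr[of "complex_of_real s" "complex_of_real t" y] by simp
    then have "(x \<oplus> x') \<oplus> complex_of_real (s + t) \<odot> y =
        (x \<oplus> complex_of_real s \<odot> y) \<oplus> (x' \<oplus> complex_of_real t \<odot> y)"
      using x ty by (simp add: M.a_ac)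
    then have "q ((x \<oplus> x') \<oplus> complex_of_real (s + t) \<odot> y) \<le>
        q (x \<oplus> complex_of_real s \<odot> y) + q (x' \<oplus> complex_of_real t \<odot> y)"
      using sublinear_add[OF q] x ty by simp
    then show "p (s + t) (x \<oplus> x') \<le> p s x + p t x'"
      unfolding p_def by (simp add: algebra_simps)
  qed (use st in simp)
  have scale: "\<exists>k\<in>{0..}. p k (complex_of_real t \<odot> x) \<le> t * p s x"
    if s: "s \<in> {0..}" and t: "t > 0" and x: "x \<in> carrier E" for s t x
  proof
    have "complex_of_real t \<odot> (x \<oplus> complex_of_real s \<odot> y) =
        complex_of_real t \<odot> x \<oplus> complex_of_real (t * s) \<odot> y"
      using x y ty smult_r_distr[of "complex_of_real t" x "complex_of_real s \<odot> y"]
        smult_assoc1[of "complex_of_real t" "complex_of_real s" y] by simp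
    then show "p (t * s) (complex_of_real t \<odot> x) \<le> t * p s x"
      using sublinear_scale[OF q t, of "x \<oplus> complex_of_real s \<odot> y"] x ty
      by (simp add: p_def algebra_simps)
  qed (use s t in simp)
  let ?q' = "\<lambda>x\<in>carrier E. INF t\<in>{0..}. p t x"
  note INF = sublinear_INF[of "{0..}" "\<lambda>x. - q (\<ominus> x)" p, OF _ lower add scale]
  have "?q' x \<le> q x" if x: "x \<in> carrier E" for x
    using INF(2)[OF _ _ _ _ _ _ _ _ _ _ x, of 0] smult_l_null[OF y] x by (simp add: p_def)
  moreover have "?q' x \<le> q (x \<oplus> y) - q y" if x: "x \<in> carrier E" for x
    using INF(2)[OF _ _ _ _ _ _ _ _ _ _ x, of 1] smult_one[OF y] x by (simp add: p_def)
  moreover have "sublinear ?q'" by (rule INF(1)) auto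
  ultimately show ?thesis by (intro bexI[of _ ?q']) auto
qed

lemma vnorm_sublinear: "sublinear (vnorm E)"
  by (simp add: sublinear_def vnorm_add_le vnorm_smult)

text \<open>
  Pointwise minimal sublinear functionals are additive: the functional below the translate
  by \<open>y\<close> must equal \<open>q\<close>, so \<open>q x \<le> q (x + y) - q y\<close>. Zorn's lemma yields a
  minimal one because pointwise infima of chains are again sublinear; they are finite as every
  sublinear \<open>q \<le> p\<close> satisfies \<open>- p (- x) \<le> q x\<close>.
\<close>

lemma additive_below_sublinear:
  assumes p: "sublinear p"
  shows "\<exists>q. sublinear q \<and> (\<forall>x\<in>carrier E. q x \<le> p x) \<and>
    (\<forall>x\<in>carrier E. \<forall>y\<in>carrier E. q (x \<oplus> y) = q x + q y)"
proof -
  define S where "S = {q \<in> extensional (carrier E). sublinear q \<and> (\<forall>x\<in>carrier E. q x \<le> p x)}"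
  define R where "R = (\<lambda>q q'. \<forall>x\<in>carrier E. q' x \<le> (q x :: real))"
  have "\<exists>m\<in>S. \<forall>q\<in>S. R m q \<longrightarrow> q = m"
  proof (rule predicate_Zorn)
    show "partial_order_on S (relation_of R S)"
    proof (rule partial_order_on_relation_ofI)
      show "R q q" for q by (simp add: R_def)
      show "R q1 q3" if "R q1 q2" "R q2 q3" for q1 q2 q3 using that unfolding R_def by force
      show "q1 = q2" if "q1 \<in> S" "q2 \<in> S" "R q1 q2" "R q2 q1" for q1 q2
        using that by (intro extensionalityI[of q1 "carrier E" q2]) (auto simp: R_def S_def intro: antisym)
    qed
    fix C assume C: "C \<in> Chains (relation_of R S)"
    have chain: "q \<in> S \<and> q' \<in> S \<and> (R q q' \<or> R q' q)" if "q \<in> C" "q' \<in> C" for q q'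
      using C that unfolding Chains_def relation_of_def by blast
    then have CS: "C \<subseteq> S" by blast
    show "\<exists>u\<in>S. \<forall>q\<in>C. R q u"
    proof (cases "C = {}")
      case True
      have "S \<noteq> {}"
        using sublinear_below_translate[OF p M.zero_closed] by (auto simp: S_def)
      then show ?thesis using True by auto
    next
      case False
      have sub: "sublinear q" "\<And>x. x \<in> carrier E \<Longrightarrow> q x \<le> p x" if "q \<in> C" for q
        using that CS unfolding S_def by auto
      have lower: "- p (\<ominus> x) \<le> q x" if "x \<in> carrier E" "q \<in> C" for x q
        using sublinear_neg[OF sub(1)] sub(2)[of q "\<ominus> x"] that by fastforce
      have add: "\<exists>k\<in>C. k (x \<oplus> y) \<le> q x + q' y"
        if "q \<in> C" "q' \<in> C" "x \<in> carrier E" "y \<in> carrier E" for q q' x y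
      proof (cases "R q q'")
        case True
        then have "q' x \<le> q x" using that by (simp add: R_def)
        then have "q' (x \<oplus> y) \<le> q x + q' y"
          using sublinear_add[OF sub(1)[OF that(2)] that(3,4)] by linarith
        then show ?thesis using that by blast
      next
        case False
        then have "q y \<le> q' y" using that chain[of q q'] by (auto simp: R_def)
        then have "q (x \<oplus> y) \<le> q x + q' y"
          using sublinear_add[OF sub(1)[OF that(1)] that(3,4)] by linarith
        then show ?thesis using that by blast
      qed
      have scale: "\<exists>k\<in>C. k (complex_of_real t \<odot> x) \<le> t * q x"
        if "q \<in> C" "t > 0" "x \<in> carrier E" for q t x
        using sublinear_scale[OF sub(1)] that by (intro bexI[of _ q]) auto
      let ?u = "\<lambda>x\<in>carrier E. INF q\<in>C. q x"
      have u: "sublinear ?u"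
        by (rule sublinear_INF(1)[where p = "\<lambda>q. q" and b = "\<lambda>x. - p (\<ominus> x)"]) (use False lower add scale in auto)
      have le: "?u x \<le> q x" if "x \<in> carrier E" "q \<in> C" for x q
        by (rule sublinear_INF(2)[where p = "\<lambda>q. q" and b = "\<lambda>x. - p (\<ominus> x)"])
          (use False lower add scale that in auto)
      obtain q0 where "q0 \<in> C" using False by blast
      then have "?u x \<le> p x" if "x \<in> carrier E" for x
        using le[OF that, of q0] sub(2)[of q0 x] that by linarith
      then have "?u \<in> S" using u by (simp add: S_def)
      moreover have "R q ?u" if "q \<in> C" for q
        unfolding R_def using le that by blast
      ultimately show ?thesis by blast
    qed
  qed
  then obtain q where q: "q \<in> S" and min: "\<And>q'. q' \<in> S \<Longrightarrow> R q q' \<Longrightarrow> q' = q" by blast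
  have sub: "sublinear q" and le: "\<And>x. x \<in> carrier E \<Longrightarrow> q x \<le> p x" using q by (auto simp: S_def)
  have "q (x \<oplus> y) = q x + q y" if x: "x \<in> carrier E" and y: "y \<in> carrier E" for x y
  proof (rule antisym)
    obtain q' where q': "q' \<in> extensional (carrier E)" "sublinear q'"
      "\<forall>x\<in>carrier E. q' x \<le> q x \<and> q' x \<le> q (x \<oplus> y) - q y"
      using sublinear_below_translate[OF sub y] by blast
    have "q' x \<le> p x" if "x \<in> carrier E" for x using q'(3) le that by force
    then have "q' = q" using q' by (intro min) (auto simp: S_def R_def)
    then show "q x + q y \<le> q (x \<oplus> y)" using q'(3) x by force
  qed (rule sublinear_add[OF sub x y])
  then show ?thesis using sub le by auto
qed

text \<open>
  The starting point is the sublinear functional below the translate of the norm by \<open>x\<^sub>0\<close>: its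
  value at \<open>- x\<^sub>0\<close> is at most minus the norm of \<open>x\<^sub>0\<close>, so anything linear below it is nonzero there.
\<close>

lemma real_functional_nonzero:
  assumes x0: "x0 \<in> carrier E" "x0 \<noteq> \<zero>"
  shows "\<exists>q. q x0 \<noteq> 0 \<and> (\<forall>x\<in>carrier E. \<bar>q x\<bar> \<le> vnorm E x) \<and>
    (\<forall>x\<in>carrier E. \<forall>y\<in>carrier E. q (x \<oplus> y) = q x + q y) \<and>
    (\<forall>t. \<forall>x\<in>carrier E. q (complex_of_real t \<odot> x) = t * q x)"
proof -
  obtain p where p: "sublinear p"
    "\<forall>x\<in>carrier E. p x \<le> vnorm E x \<and> p x \<le> vnorm E (x \<oplus> x0) - vnorm E x0"
    using sublinear_below_translate[OF vnorm_sublinear x0(1)] by blast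
  obtain q where q: "sublinear q" "\<forall>x\<in>carrier E. q x \<le> p x"
    and q_add: "\<forall>x\<in>carrier E. \<forall>y\<in>carrier E. q (x \<oplus> y) = q x + q y"
    using additive_below_sublinear[OF p(1)] by blast
  have le: "q x \<le> vnorm E x" "q x \<le> vnorm E (x \<oplus> x0) - vnorm E x0" if "x \<in> carrier E" for x
    using p(2) q(2) that by force+
  have neg: "q (\<ominus> x) = - q x" if "x \<in> carrier E" for x
    using q_add[rule_format, of x "\<ominus> x"] that sublinear_zero[OF q(1)] by (simp add: M.r_neg)
  have "q (\<ominus> x0) \<le> - vnorm E x0"
    using le(2)[of "\<ominus> x0"] x0 by (simp add: M.l_neg vnorm_zero)
  then have "q x0 \<noteq> 0" using neg[OF x0(1)] vnorm_nonneg[OF x0(1)] vnorm_eq_0_iff[OF x0(1)] x0(2) by simp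
  moreover have "\<bar>q x\<bar> \<le> vnorm E x" if "x \<in> carrier E" for x
    using le(1)[OF that] le(1)[of "\<ominus> x"] neg[OF that] that
    by (simp add: vnorm_minus)
  moreover have "q (complex_of_real t \<odot> x) = t * q x" if x: "x \<in> carrier E" for t x
  proof -
    consider "t > 0" | "t = 0" | "t < 0" by linarith
    then show ?thesis
    proof cases
      case 1 then show ?thesis using sublinear_scale[OF q(1) _ x] by simp
    next
      case 2 then show ?thesis using sublinear_zero[OF q(1)] smult_l_null[OF x] by simp
    next
      case 3
      have "complex_of_real t \<odot> x = \<ominus> (complex_of_real (- t) \<odot> x)"
        using x smult_assoc1[of "- 1" "complex_of_real (- t)" x]
          neg_one_smult[of "complex_of_real (- t) \<odot> x"] by simp
      then show ?thesis using neg[of "complex_of_real (- t) \<odot> x"] sublinear_scale[OF q(1) _ x, of "- t"] 3 x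
        by simp
    qed
  qed
  ultimately show ?thesis using q_add by blast
qed

text \<open>
  The complex functional with real part \<open>q\<close> is \<open>q x - \<i> q (\<i> x)\<close>. The crude bound 2 on its norm
  suffices, as only boundedness matters.
\<close>

lemma functional_nonzero:
  assumes x0: "x0 \<in> carrier E" "x0 \<noteq> \<zero>"
  shows "\<exists>f\<in>carrier (dual E). f x0 \<noteq> 0"
proof -
  obtain q where q0: "q x0 \<noteq> 0" and "\<forall>x\<in>carrier E. \<bar>q x\<bar> \<le> vnorm E x"
    "\<forall>x\<in>carrier E. \<forall>y\<in>carrier E. q (x \<oplus> y) = q x + q y"
    "\<forall>t. \<forall>x\<in>carrier E. q (complex_of_real t \<odot> x) = t * q x"
    using real_functional_nonzero[OF x0] by blast
  then have q_le: "\<And>x. x \<in> carrier E \<Longrightarrow> \<bar>q x\<bar> \<le> vnorm E x"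
    and q_add: "\<And>x y. x \<in> carrier E \<Longrightarrow> y \<in> carrier E \<Longrightarrow> q (x \<oplus> y) = q x + q y"
    and q_smult: "\<And>t x. x \<in> carrier E \<Longrightarrow> q (complex_of_real t \<odot> x) = t * q x"
    by auto
  define f where "f = (\<lambda>x\<in>carrier E. Complex (q x) (- q (\<i> \<odot> x)))"
  have closed: "c \<odot> x \<in> carrier E" if "x \<in> carrier E" for c x using that by simp
  have "f (x \<oplus> y) = f x + f y" if "x \<in> carrier E" "y \<in> carrier E" for x y
    using that q_add smult_r_distr[of \<i> x y] by (simp add: f_def closed complex_eq_iff)
  moreover have "f (c \<odot> x) = c * f x" if x: "x \<in> carrier E" for c x
  proof -
    have smult: "(complex_of_real a + complex_of_real b * \<i>) \<odot> x =
        complex_of_real a \<odot> x \<oplus> complex_of_real b \<odot> (\<i> \<odot> x)" for a b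
      using x smult_l_distr[of "complex_of_real a" "complex_of_real b * \<i>" x]
        smult_assoc1[of "complex_of_real b" \<i> x] by simp
    have qs: "q ((complex_of_real a + complex_of_real b * \<i>) \<odot> x) = a * q x + b * q (\<i> \<odot> x)" for a b
      unfolding smult using q_add q_smult x closed by simp
    have "c = complex_of_real (Re c) + complex_of_real (Im c) * \<i>"
      "\<i> * c = complex_of_real (- Im c) + complex_of_real (Re c) * \<i>"
      by (simp_all add: complex_eq_iff)
    then have "q (c \<odot> x) = Re c * q x + Im c * q (\<i> \<odot> x)"
      "q ((\<i> * c) \<odot> x) = - Im c * q x + Re c * q (\<i> \<odot> x)"
      using qs by metis+
    then show ?thesis
      using x closed smult_assoc1[of \<i> c x] by (simp add: f_def complex_eq_iff)
  qed
  moreover have "cmod (f x) \<le> 2 * vnorm E x" if x: "x \<in> carrier E" for x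
    using cmod_le[of "f x"] q_le[OF x] q_le[OF closed[OF x], of \<i>] vnorm_smult[OF x, of \<i>] x
    by (simp add: f_def)
  ultimately have "f \<in> carrier (dual E)"
    by (intro dualI[where K = 2]) (simp_all only: f_def restrict_extensional)
  moreover have "f x0 \<noteq> 0" using q0 x0 by (simp add: f_def complex_eq_iff)
  ultimately show ?thesis by blast
qed

end


section \<open>The canonical embedding into the bidual\<close>

definition bidual_embed :: "'e normed_mod \<Rightarrow> 'e \<Rightarrow> ('e \<Rightarrow> complex) \<Rightarrow> complex" where
  "bidual_embed E x = (\<lambda>f\<in>carrier (dual E). f x)"

context complex_normed_space begin

lemma bidual_embed_closed:
  assumes x: "x \<in> carrier E" shows "bidual_embed E x \<in> carrier (dual (dual E))"
proof (rule dualI[where K = "vnorm E x"])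
  show "cmod (bidual_embed E x f) \<le> vnorm E x * vnorm (dual E) f" if "f \<in> carrier (dual E)" for f
    using dual_apply_le[OF that x] that by (simp add: bidual_embed_def mult.commute)
qed (use x in \<open>simp_all add: bidual_embed_def dual_add_closed dual_smult_closed, simp_all add: dual_simps(1,2)\<close>)

lemma bidual_embed_linear: "linear_map E (dual (dual E)) (bidual_embed E)"
proof -
  have "bidual_embed E (x \<oplus> y) = bidual_embed E x \<oplus>\<^bsub>dual (dual E)\<^esub> bidual_embed E y"
    if "x \<in> carrier E" "y \<in> carrier E" for x y
    unfolding dual_simps(1) bidual_embed_def using that by (intro restrict_ext) (simp add: dualD(2))
  moreover have "bidual_embed E (c \<odot> x) = c \<odot>\<^bsub>dual (dual E)\<^esub> bidual_embed E x"
    if "x \<in> carrier E" for c x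
    unfolding dual_simps(2) bidual_embed_def using that by (intro restrict_ext) (simp add: dualD(3))
  ultimately show ?thesis by (simp add: linear_map_def bidual_embed_closed)
qed

lemma bidual_embed_vnorm_le:
  assumes x: "x \<in> carrier E" shows "vnorm (dual (dual E)) (bidual_embed E x) \<le> vnorm E x"
proof -
  interpret D: complex_normed_space "dual E" by (rule dual_normed)
  show ?thesis
    using dual_apply_le[OF _ x] vnorm_nonneg[OF x]
    by (intro D.dual_vnorm_le) (simp_all add: bidual_embed_def mult.commute)
qed

text \<open>The embedding is injective because bounded functionals separate points.\<close>

lemma bidual_embed_eq_zero:
  assumes x: "x \<in> carrier E" and 0: "bidual_embed E x = \<zero>\<^bsub>dual (dual E)\<^esub>"
  shows "x = \<zero>"
proof (rule ccontr)
  assume "x \<noteq> \<zero>"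
  then obtain f where f: "f \<in> carrier (dual E)" "f x \<noteq> 0" using functional_nonzero[OF x] by blast
  have "bidual_embed E x f = 0" unfolding 0 using f(1) by (simp add: dual_simps(3))
  then show False using f by (simp add: bidual_embed_def)
qed

end


section \<open>Dual bimodules\<close>

context banach_bimodule begin

lemma dual_l_closed:
  assumes b: "b \<in> carrier B" and f: "f \<in> carrier (dual M)"
  shows "dual_l M r b f \<in> carrier (dual M)"
    and "vnorm (dual M) (dual_l M r b f) \<le> vnorm B b * vnorm (dual M) f"
proof -
  have nn: "0 \<le> vnorm B b * vnorm (dual M) f"
    using B.vnorm_nonneg[OF b] M.dual_vnorm_nonneg[OF f] by simp
  have le: "cmod (dual_l M r b f x) \<le> (vnorm B b * vnorm (dual M) f) * vnorm M x"
    if x: "x \<in> carrier M" for x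
  proof -
    have "cmod (f (r x b)) \<le> vnorm (dual M) f * vnorm M (r x b)"
      by (rule M.dual_apply_le[OF f r_closed[OF b x]])
    also have "\<dots> \<le> vnorm (dual M) f * (vnorm M x * vnorm B b)"
      by (rule mult_left_mono[OF r_norm[OF b x] M.dual_vnorm_nonneg[OF f]])
    finally show ?thesis using x by (simp add: dual_l_def mult_ac)
  qed
  then show "vnorm (dual M) (dual_l M r b f) \<le> vnorm B b * vnorm (dual M) f"
    by (intro M.dual_vnorm_le nn)
  have "dual_l M r b f \<in> extensional (carrier M)" by (simp add: dual_l_def)
  then show "dual_l M r b f \<in> carrier (dual M)"
    by (rule dualI[OF _ _ _ le])
      (use b f in \<open>simp_all add: dual_l_def r_add_left r_smult_left r_closed dualD(2,3)\<close>)
qed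

lemma dual_r_closed:
  assumes a: "a \<in> carrier A" and f: "f \<in> carrier (dual M)"
  shows "dual_r M l f a \<in> carrier (dual M)"
    and "vnorm (dual M) (dual_r M l f a) \<le> vnorm (dual M) f * vnorm A a"
proof -
  have nn: "0 \<le> vnorm (dual M) f * vnorm A a"
    using A.vnorm_nonneg[OF a] M.dual_vnorm_nonneg[OF f] by simp
  have le: "cmod (dual_r M l f a x) \<le> (vnorm (dual M) f * vnorm A a) * vnorm M x"
    if x: "x \<in> carrier M" for x
  proof -
    have "cmod (f (l a x)) \<le> vnorm (dual M) f * vnorm M (l a x)"
      by (rule M.dual_apply_le[OF f l_closed[OF a x]])
    also have "\<dots> \<le> vnorm (dual M) f * (vnorm A a * vnorm M x)"
      by (rule mult_left_mono[OF l_norm[OF a x] M.dual_vnorm_nonneg[OF f]])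
    finally show ?thesis using x by (simp add: dual_r_def mult_ac)
  qed
  then show "vnorm (dual M) (dual_r M l f a) \<le> vnorm (dual M) f * vnorm A a"
    by (intro M.dual_vnorm_le nn)
  have "dual_r M l f a \<in> extensional (carrier M)" by (simp add: dual_r_def)
  then show "dual_r M l f a \<in> carrier (dual M)"
    by (rule dualI[OF _ _ _ le])
      (use a f in \<open>simp_all add: dual_r_def l_add_right l_smult_right l_closed dualD(2,3)\<close>)
qed

text \<open>
  The sides change because an element that acts on \<open>M\<close> from the right acts on functionals
  by precomposition, and thereby from the left.
\<close>

lemma dual_bimodule: "banach_bimodule B A (dual M) (dual_l M r) (dual_r M l)"
  by (intro banach_bimodule.intro banach_bimodule_axioms.intro
      B.complex_banach_algebra_axioms A.complex_banach_algebra_axioms M.dual_banach)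
    (auto simp: dual_l_closed dual_r_closed,
     auto simp: dual_l_def dual_r_def dual_simps(1,2) l_closed r_closed l_mult r_mult l_add_left r_add_right
       l_smult_left r_smult_right dualD(2,3) l_r algebra_simps intro!: restrict_ext)

text \<open>
  The embedding into the bidual is a bimodule homomorphism; it turns derivations into \<open>M\<close> into
  derivations into a dual bimodule.
\<close>

lemma bidual_embed_l:
  assumes "a \<in> carrier A" "x \<in> carrier M"
  shows "bidual_embed M (l a x) = dual_l (dual M) (dual_r M l) a (bidual_embed M x)"
  using assms unfolding dual_l_def[of "dual M"] bidual_embed_def
  by (intro restrict_ext) (simp add: dual_r_closed, simp add: dual_r_def)

lemma bidual_embed_r:
  assumes "b \<in> carrier B" "x \<in> carrier M"
  shows "bidual_embed M (r x b) = dual_r (dual M) (dual_l M r) (bidual_embed M x) b"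
  using assms unfolding dual_r_def[of "dual M"] bidual_embed_def
  by (intro restrict_ext) (simp add: dual_l_closed, simp add: dual_l_def)

lemma l_zero_left: "x \<in> carrier M \<Longrightarrow> l \<zero>\<^bsub>A\<^esub> x = \<zero>\<^bsub>M\<^esub>"
  using l_add_left[of "\<zero>\<^bsub>A\<^esub>" "\<zero>\<^bsub>A\<^esub>" x] l_closed[of "\<zero>\<^bsub>A\<^esub>" x] by simp

lemma r_zero_right: "x \<in> carrier M \<Longrightarrow> r x \<zero>\<^bsub>B\<^esub> = \<zero>\<^bsub>M\<^esub>"
  using r_add_right[of "\<zero>\<^bsub>B\<^esub>" "\<zero>\<^bsub>B\<^esub>" x] r_closed[of "\<zero>\<^bsub>B\<^esub>" x] by simp

end


section \<open>Amenability passes to quotients\<close>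

definition contractive_hom :: "'c normed_mod \<Rightarrow> 'd normed_mod \<Rightarrow> ('c \<Rightarrow> 'd) \<Rightarrow> bool" where
  "contractive_hom C D \<phi> \<longleftrightarrow> linear_map C D \<phi> \<and>
     (\<forall>x\<in>carrier C. \<forall>y\<in>carrier C. \<phi> (x \<otimes>\<^bsub>C\<^esub> y) = \<phi> x \<otimes>\<^bsub>D\<^esub> \<phi> y) \<and>
     (\<forall>x\<in>carrier C. vnorm D (\<phi> x) \<le> vnorm C x)"

lemma contractive_homD:
  assumes "contractive_hom C D \<phi>"
  shows "linear_map C D \<phi>"
    and "x \<in> carrier C \<Longrightarrow> \<phi> x \<in> carrier D"
    and "x \<in> carrier C \<Longrightarrow> y \<in> carrier C \<Longrightarrow> \<phi> (x \<oplus>\<^bsub>C\<^esub> y) = \<phi> x \<oplus>\<^bsub>D\<^esub> \<phi> y"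
    and "x \<in> carrier C \<Longrightarrow> \<phi> (c \<odot>\<^bsub>C\<^esub> x) = c \<odot>\<^bsub>D\<^esub> \<phi> x"
    and "x \<in> carrier C \<Longrightarrow> y \<in> carrier C \<Longrightarrow> \<phi> (x \<otimes>\<^bsub>C\<^esub> y) = \<phi> x \<otimes>\<^bsub>D\<^esub> \<phi> y"
    and "x \<in> carrier C \<Longrightarrow> vnorm D (\<phi> x) \<le> vnorm C x"
  using assms by (auto simp: contractive_hom_def linear_map_def)

lemma contractive_hom_continuous:
  assumes "complex_normed_space C" "complex_normed_space D" "contractive_hom C D \<phi>"
  shows "continuous_map (ntop C) (ntop D) \<phi>"
  using assms contractive_homD(6)[OF assms(3)]
  by (intro bounded_linear_map_continuous[where K = 1] contractive_homD(1)) auto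

text \<open>
  Applied with \<open>i\<close> the inclusion of a diagonal algebra into the triangular algebra and \<open>p\<close> the
  projection back, this makes the restrictions of an endomorphism continuous endomorphisms.
\<close>

lemma continuous_endo_sandwich:
  assumes "complex_normed_space C" "complex_normed_space D"
    and i: "contractive_hom C D i" and p: "contractive_hom D C p" and s: "continuous_endo D \<sigma>"
  shows "continuous_endo C (\<lambda>x. p (\<sigma> (i x)))"
proof -
  have lin: "linear_map D D \<sigma>"
    and mult: "\<And>x y. x \<in> carrier D \<Longrightarrow> y \<in> carrier D \<Longrightarrow> \<sigma> (x \<otimes>\<^bsub>D\<^esub> y) = \<sigma> x \<otimes>\<^bsub>D\<^esub> \<sigma> y"
    and cont: "continuous_map (ntop D) (ntop D) \<sigma>"
    using s by (auto simp: continuous_endo_def algebra_endo_def)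
  have sc: "\<sigma> x \<in> carrier D" if "x \<in> carrier D" for x using lin that by (auto simp: linear_map_def)
  have "linear_map C C (\<lambda>x. p (\<sigma> (i x)))"
    by (intro linear_map_comp[OF _ contractive_homD(1)[OF p]] linear_map_comp[OF _ lin] contractive_homD(1)[OF i])
  moreover have "p (\<sigma> (i (x \<otimes>\<^bsub>C\<^esub> y))) = p (\<sigma> (i x)) \<otimes>\<^bsub>C\<^esub> p (\<sigma> (i y))"
    if "x \<in> carrier C" "y \<in> carrier C" for x y
    using that by (simp add: contractive_homD(2,5)[OF i] contractive_homD(5)[OF p] mult sc)
  moreover have "continuous_map (ntop C) (ntop C) (p \<circ> (\<sigma> \<circ> i))"
    by (intro continuous_map_compose[OF _ contractive_hom_continuous[OF assms(2,1) p]]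
        continuous_map_compose[OF contractive_hom_continuous[OF assms(1,2) i] cont])
  ultimately show ?thesis by (simp add: continuous_endo_def algebra_endo_def o_def)
qed

lemma bimodule_pullback:
  assumes "banach_bimodule A B M l r" "complex_banach_algebra C" "complex_banach_algebra D"
    and \<phi>: "contractive_hom C A \<phi>" and \<psi>: "contractive_hom D B \<psi>"
  shows "banach_bimodule C D M (\<lambda>c. l (\<phi> c)) (\<lambda>x d. r x (\<psi> d))"
proof -
  interpret banach_bimodule A B M l r by fact
  interpret C: complex_banach_algebra C by fact
  interpret D: complex_banach_algebra D by fact
  have "vnorm M (l (\<phi> c) x) \<le> vnorm C c * vnorm M x" if "c \<in> carrier C" "x \<in> carrier M" for c x
    using l_norm[of "\<phi> c" x] mult_right_mono[OF contractive_homD(6)[OF \<phi>], of c "vnorm M x"]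
      M.vnorm_nonneg that contractive_homD(2)[OF \<phi>] by fastforce
  moreover have "vnorm M (r x (\<psi> d)) \<le> vnorm M x * vnorm D d" if "d \<in> carrier D" "x \<in> carrier M" for d x
    using r_norm[of "\<psi> d" x] mult_left_mono[OF contractive_homD(6)[OF \<psi>], of d "vnorm M x"]
      M.vnorm_nonneg that contractive_homD(2)[OF \<psi>] by fastforce
  ultimately show ?thesis
    by (intro banach_bimodule.intro banach_bimodule_axioms.intro C.complex_banach_algebra_axioms
        D.complex_banach_algebra_axioms M.complex_banach_space_axioms)
      (simp_all add: contractive_homD(2-5)[OF \<phi>] contractive_homD(2-5)[OF \<psi>] l_closed r_closed
        l_add_left l_add_right r_add_left r_add_right l_smult_left l_smult_right r_smult_left
        r_smult_right l_mult r_mult l_r)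
qed

text \<open>
  A test bimodule for the quotient is a test bimodule for the whole algebra through \<open>p\<close>, and a
  derivation composed with \<open>p\<close> is implemented by a functional on the same space. Surjectivity of
  \<open>p\<close> then shows that this functional implements the original derivation.
\<close>

lemma amenable_quotient:
  assumes am: "amenable TYPE('e) C \<sigma> \<tau>"
    and C': "complex_banach_algebra C'" "continuous_endo C' \<sigma>'" "continuous_endo C' \<tau>'"
    and p: "contractive_hom C C' p" and surj: "carrier C' \<subseteq> p ` carrier C"
    and inter: "\<And>x. x \<in> carrier C \<Longrightarrow> p (\<sigma> x) = \<sigma>' (p x)" "\<And>x. x \<in> carrier C \<Longrightarrow> p (\<tau> x) = \<tau>' (p x)"
  shows "amenable TYPE('e) C' \<sigma>' \<tau>'"
  unfolding amenable_def
proof (intro conjI C' allI impI)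
  fix E :: "'e normed_mod" and l r d
  assume E: "banach_bimodule C' C' E l r"
    and d: "derivation C' (dual E) (dual_l E r) (dual_r E l) \<sigma>' \<tau>' d"
    and cont: "continuous_map (ntop C') (ntop (dual E)) d"
  interpret C': complex_banach_algebra C' by fact
  have C: "complex_banach_algebra C" using am by (simp add: amenable_def)
  then interpret C: complex_banach_algebra C .
  let ?l = "\<lambda>c. l (p c)" and ?r = "\<lambda>x c. r x (p c)"
  have acts: "dual_l E ?r c = dual_l E r (p c)" "dual_r E ?l f c = dual_r E l f (p c)" for c f
    by (simp_all add: dual_l_def dual_r_def fun_eq_iff)
  have "banach_bimodule C C E ?l ?r" by (rule bimodule_pullback[OF E C C p p])
  moreover have "derivation C (dual E) (dual_l E ?r) (dual_r E ?l) \<sigma> \<tau> (\<lambda>x. d (p x))"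
    using d linear_map_comp[OF contractive_homD(1)[OF p], of "dual E" d] contractive_homD(2,5)[OF p] inter
    by (simp add: derivation_def acts)
  moreover have "continuous_map (ntop C) (ntop (dual E)) (d \<circ> p)"
    by (rule continuous_map_compose[OF contractive_hom_continuous[OF C.complex_normed_space_axioms
        C'.complex_normed_space_axioms p] cont])
  ultimately have "inner_derivation C (dual E) (dual_l E ?r) (dual_r E ?l) \<sigma> \<tau> (\<lambda>x. d (p x))"
    using am unfolding amenable_def o_def by blast
  then obtain f where f: "f \<in> carrier (dual E)"
    "\<And>x. x \<in> carrier C \<Longrightarrow> d (p x) = dual_l E r (\<tau>' (p x)) f \<ominus>\<^bsub>dual E\<^esub> dual_r E l f (\<sigma>' (p x))"
    unfolding inner_derivation_def acts using inter by auto
  then show "inner_derivation C' (dual E) (dual_l E r) (dual_r E l) \<sigma>' \<tau>' d"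
    unfolding inner_derivation_def using surj by (intro bexI[of _ f]) auto
qed


section \<open>Endomorphisms of a triangular algebra that fix the diagonal idempotents\<close>

context complex_banach_algebra begin

lemma mult_zero_left: "x \<in> carrier C \<Longrightarrow> \<zero> \<otimes> x = \<zero>"
  using mult_add_left[of \<zero> \<zero> x] mult_closed[of \<zero> x] by simp

lemma mult_zero_right: "x \<in> carrier C \<Longrightarrow> x \<otimes> \<zero> = \<zero>"
  using mult_add_right[of x \<zero> \<zero>] mult_closed[of x \<zero>] by simp

end

context unital_banach_bimodule begin

lemmas tri_zero_simps = l_zero r_zero l_zero_left r_zero_right A.mult_zero_left A.mult_zero_right
  B.mult_zero_left B.mult_zero_right A.mult_one_left A.mult_one_right B.mult_one_left B.mult_one_right
  l_one r_one A.one_closed B.one_closed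

lemma peirce:
  assumes "a \<in> carrier A" "m \<in> carrier M" "b \<in> carrier B"
  shows "diag M \<one>\<^bsub>A\<^esub> \<zero>\<^bsub>B\<^esub> \<otimes>\<^bsub>T\<^esub> (a, m, b) \<otimes>\<^bsub>T\<^esub> diag M \<one>\<^bsub>A\<^esub> \<zero>\<^bsub>B\<^esub> = diag M a \<zero>\<^bsub>B\<^esub>"
    and "diag M \<one>\<^bsub>A\<^esub> \<zero>\<^bsub>B\<^esub> \<otimes>\<^bsub>T\<^esub> (a, m, b) \<otimes>\<^bsub>T\<^esub> diag M \<zero>\<^bsub>A\<^esub> \<one>\<^bsub>B\<^esub> = corner A B m"
    and "diag M \<zero>\<^bsub>A\<^esub> \<one>\<^bsub>B\<^esub> \<otimes>\<^bsub>T\<^esub> (a, m, b) \<otimes>\<^bsub>T\<^esub> diag M \<zero>\<^bsub>A\<^esub> \<one>\<^bsub>B\<^esub> = diag M \<zero>\<^bsub>A\<^esub> b"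
  using assms by (simp_all add: diag_def corner_def tri_zero_simps)

abbreviation "fixes_diagonal \<sigma> \<equiv> \<sigma> (diag M \<one>\<^bsub>A\<^esub> \<zero>\<^bsub>B\<^esub>) = diag M \<one>\<^bsub>A\<^esub> \<zero>\<^bsub>B\<^esub> \<and>
  \<sigma> (diag M \<zero>\<^bsub>A\<^esub> \<one>\<^bsub>B\<^esub>) = diag M \<zero>\<^bsub>A\<^esub> \<one>\<^bsub>B\<^esub>"

definition restrict_M :: "('a \<times> 'm \<times> 'b \<Rightarrow> 'a \<times> 'm \<times> 'b) \<Rightarrow> 'm \<Rightarrow> 'm" where
  "restrict_M \<sigma> m = fst (snd (\<sigma> (corner A B m)))"

text \<open>
  The corners of a matrix are cut out by multiplying with the diagonal idempotents on both sides,
  so an endomorphism that fixes these idempotents acts corner by corner.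
\<close>

lemma endo_components:
  assumes \<sigma>: "algebra_endo T \<sigma>" "fixes_diagonal \<sigma>"
    and abm: "a \<in> carrier A" "m \<in> carrier M" "b \<in> carrier B"
  shows "\<sigma> (a, m, b) = (restrict_A M B \<sigma> a, restrict_M \<sigma> m, restrict_B A M \<sigma> b)"
    and "\<sigma> (corner A B m) = corner A B (restrict_M \<sigma> m)"
proof -
  interpret T: unital_complex_banach_algebra T by (rule tri_unital_banach_algebra)
  have mult: "\<And>s t. s \<in> carrier T \<Longrightarrow> t \<in> carrier T \<Longrightarrow> \<sigma> (s \<otimes>\<^bsub>T\<^esub> t) = \<sigma> s \<otimes>\<^bsub>T\<^esub> \<sigma> t"
    and closed: "\<And>t. t \<in> carrier T \<Longrightarrow> \<sigma> t \<in> carrier T"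
    using \<sigma> by (auto simp: algebra_endo_def linear_map_def)
  let ?e = "diag M \<one>\<^bsub>A\<^esub> \<zero>\<^bsub>B\<^esub>" and ?f = "diag M \<zero>\<^bsub>A\<^esub> \<one>\<^bsub>B\<^esub>"
  have t: "(a, m, b) \<in> carrier T" using abm by simp
  have ef: "?e \<in> carrier T" "?f \<in> carrier T"
    by (simp_all add: diag_def A.one_closed B.one_closed)
  have cut: "\<sigma> (u \<otimes>\<^bsub>T\<^esub> (a, m, b) \<otimes>\<^bsub>T\<^esub> v) = u \<otimes>\<^bsub>T\<^esub> \<sigma> (a, m, b) \<otimes>\<^bsub>T\<^esub> v"
    if "u \<in> {?e, ?f}" "v \<in> {?e, ?f}" for u v
  proof -
    have uv: "u \<in> carrier T" "v \<in> carrier T" "\<sigma> u = u" "\<sigma> v = v" using that \<sigma>(2) ef by auto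
    show ?thesis using mult[OF T.mult_closed[OF uv(1) t] uv(2)] mult[OF uv(1) t] uv by simp
  qed
  obtain a' m' b' where t': "\<sigma> (a, m, b) = (a', m', b')" "a' \<in> carrier A" "m' \<in> carrier M" "b' \<in> carrier B"
    using closed[OF t] by (cases "\<sigma> (a, m, b)") auto
  note cut = cut[unfolded t'(1)]
  have "\<sigma> (diag M a \<zero>\<^bsub>B\<^esub>) = diag M a' \<zero>\<^bsub>B\<^esub>"
    using cut[of ?e ?e] by (simp only: peirce abm t'(2-4)) simp
  moreover have m: "\<sigma> (corner A B m) = corner A B m'"
    using cut[of ?e ?f] by (simp only: peirce abm t'(2-4)) simp
  moreover have "\<sigma> (diag M \<zero>\<^bsub>A\<^esub> b) = diag M \<zero>\<^bsub>A\<^esub> b'"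
    using cut[of ?f ?f] by (simp only: peirce abm t'(2-4)) simp
  ultimately show "\<sigma> (a, m, b) = (restrict_A M B \<sigma> a, restrict_M \<sigma> m, restrict_B A M \<sigma> b)"
    by (simp add: t'(1) restrict_A_def restrict_B_def restrict_M_def diag_def corner_def)
  show "\<sigma> (corner A B m) = corner A B (restrict_M \<sigma> m)"
    unfolding restrict_M_def m by (simp add: corner_def)
qed

lemma tri_projections:
  "contractive_hom T A fst" "contractive_hom T B (\<lambda>t. snd (snd t))"
  using A.vnorm_nonneg B.vnorm_nonneg M.vnorm_nonneg
  by (auto simp: contractive_hom_def linear_map_def add_nonneg_nonneg)

lemma tri_inclusions:
  "contractive_hom A T (\<lambda>a. diag M a \<zero>\<^bsub>B\<^esub>)" "contractive_hom B T (\<lambda>b. diag M \<zero>\<^bsub>A\<^esub> b)"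
  by (simp_all add: contractive_hom_def linear_map_def diag_def tri_zero_simps
      A.vnorm_zero B.vnorm_zero M.vnorm_zero A.smult_r_null B.smult_r_null M.smult_r_null)

lemma restrict_continuous:
  assumes "continuous_endo T \<sigma>"
  shows "continuous_endo A (restrict_A M B \<sigma>)" "continuous_endo B (restrict_B A M \<sigma>)"
  using continuous_endo_sandwich[OF A.complex_normed_space_axioms normed_T tri_inclusions(1) tri_projections(1) assms]
    continuous_endo_sandwich[OF B.complex_normed_space_axioms normed_T tri_inclusions(2) tri_projections(2) assms]
  by (simp_all add: restrict_A_def[abs_def] restrict_B_def[abs_def])

lemma diagonal_amenable:
  assumes am: "amenable TYPE('e) T \<sigma> \<tau>" and fix_diag: "fixes_diagonal \<sigma>" "fixes_diagonal \<tau>"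
  shows "amenable TYPE('e) A (restrict_A M B \<sigma>) (restrict_A M B \<tau>)"
    and "amenable TYPE('e) B (restrict_B A M \<sigma>) (restrict_B A M \<tau>)"
proof -
  have c: "continuous_endo T \<sigma>" "continuous_endo T \<tau>" using am by (auto simp: amenable_def)
  then have e: "algebra_endo T \<sigma>" "algebra_endo T \<tau>" by (auto simp: continuous_endo_def)
  note comp = endo_components(1)[OF e(1) fix_diag(1)] endo_components(1)[OF e(2) fix_diag(2)]
  show "amenable TYPE('e) A (restrict_A M B \<sigma>) (restrict_A M B \<tau>)"
  proof (rule amenable_quotient[OF am A.complex_banach_algebra_axioms
        restrict_continuous(1)[OF c(1)] restrict_continuous(1)[OF c(2)] tri_projections(1)])
    have "a \<in> fst ` carrier T" if "a \<in> carrier A" for a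
      using that by (intro image_eqI[of _ _ "diag M a \<zero>\<^bsub>B\<^esub>"]) (simp_all add: diag_def)
    then show "carrier A \<subseteq> fst ` carrier T" by blast
  qed (auto simp: comp)
  show "amenable TYPE('e) B (restrict_B A M \<sigma>) (restrict_B A M \<tau>)"
  proof (rule amenable_quotient[OF am B.complex_banach_algebra_axioms
        restrict_continuous(2)[OF c(1)] restrict_continuous(2)[OF c(2)] tri_projections(2)])
    have "b \<in> (\<lambda>t. snd (snd t)) ` carrier T" if "b \<in> carrier B" for b
      using that by (intro image_eqI[of _ _ "diag M \<zero>\<^bsub>A\<^esub> b"]) (simp_all add: diag_def)
    then show "carrier B \<subseteq> (\<lambda>t. snd (snd t)) ` carrier T" by blast
  qed (auto simp: comp)
qed


section \<open>The derivation that detects the corner\<close>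

text \<open>
  The test bimodule is \<open>M\<^sup>*\<close>, a \<open>B\<close>-\<open>A\<close>-bimodule pulled back to the triangular algebra along
  its two projections, and the derivation is the action of \<open>\<sigma>\<close> on the corner, viewed in \<open>M\<^sup>*\<^sup>*\<close>.
  The product rule is the formula \<open>a m' + m b'\<close> for the corner of a product.
\<close>

lemma corner_map_zero:
  assumes am: "amenable TYPE('m \<Rightarrow> complex) T \<sigma> \<sigma>" and fix_diag: "fixes_diagonal \<sigma>"
    and m: "m \<in> carrier M"
  shows "restrict_M \<sigma> m = \<zero>\<^bsub>M\<^esub>"
proof -
  have cont: "continuous_endo T \<sigma>" using am by (auto simp: amenable_def)
  then have endo: "algebra_endo T \<sigma>" by (auto simp: continuous_endo_def)
  have lin: "linear_map T T \<sigma>"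
    and mult: "\<And>s t. s \<in> carrier T \<Longrightarrow> t \<in> carrier T \<Longrightarrow> \<sigma> (s \<otimes>\<^bsub>T\<^esub> t) = \<sigma> s \<otimes>\<^bsub>T\<^esub> \<sigma> t"
    and closed: "\<And>t. t \<in> carrier T \<Longrightarrow> \<sigma> t \<in> carrier T"
    using endo by (auto simp: algebra_endo_def linear_map_def)
  have T: "complex_banach_algebra T"
    using tri_unital_banach_algebra by (simp add: unital_complex_banach_algebra_def)
  define lD where "lD = (\<lambda>t :: 'a \<times> 'm \<times> 'b. dual_l M r (snd (snd t)))"
  define rD where "rD = (\<lambda>f (t :: 'a \<times> 'm \<times> 'b). dual_r M l f (fst t))"
  let ?DD = "dual (dual M)"
  define D where "D = (\<lambda>t. bidual_embed M (fst (snd (\<sigma> t))))"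
  have bim: "banach_bimodule T T (dual M) lD rD"
    unfolding lD_def rD_def
    by (rule bimodule_pullback[OF dual_bimodule T T tri_projections(2) tri_projections(1)])
  interpret M': banach_bimodule B A "dual M" "dual_l M r" "dual_r M l" by (rule dual_bimodule)
  \<comment> \<open>The two dualizations turn the bidual back into an \<open>A\<close>-\<open>B\<close>-bimodule.\<close>
  interpret M'': banach_bimodule A B ?DD "dual_l (dual M) (dual_r M l)" "dual_r (dual M) (dual_l M r)"
    by (rule M'.dual_bimodule)
  have acts: "dual_l (dual M) rD t = dual_l (dual M) (dual_r M l) (fst t)"
    "dual_r (dual M) lD F t = dual_r (dual M) (dual_l M r) F (snd (snd t))" for t F
    by (simp_all add: fun_eq_iff lD_def rD_def dual_l_def[of "dual M"] dual_r_def[of "dual M"])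
  have pr: "linear_map T M (\<lambda>t. fst (snd t))" by (auto simp: linear_map_def)
  have D_lin: "linear_map T ?DD D"
    unfolding D_def by (intro linear_map_comp[OF _ M.bidual_embed_linear] linear_map_comp[OF _ pr] lin)
  have embed_add: "bidual_embed M (x \<oplus>\<^bsub>M\<^esub> y) = bidual_embed M x \<oplus>\<^bsub>?DD\<^esub> bidual_embed M y"
    if "x \<in> carrier M" "y \<in> carrier M" for x y
    using M.bidual_embed_linear that by (simp add: linear_map_def)
  have D_mult: "D (s \<otimes>\<^bsub>T\<^esub> t) = dual_r (dual M) lD (D s) (\<sigma> t) \<oplus>\<^bsub>?DD\<^esub> dual_l (dual M) rD (\<sigma> s) (D t)"
    if s: "s \<in> carrier T" and t: "t \<in> carrier T" for s t
  proof -
    obtain a x b where s': "\<sigma> s = (a, x, b)" "a \<in> carrier A" "x \<in> carrier M" "b \<in> carrier B"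
      using closed[OF s] by (cases "\<sigma> s") auto
    obtain a' x' b' where t': "\<sigma> t = (a', x', b')" "a' \<in> carrier A" "x' \<in> carrier M" "b' \<in> carrier B"
      using closed[OF t] by (cases "\<sigma> t") auto
    have "D (s \<otimes>\<^bsub>T\<^esub> t) = bidual_embed M (r x b' \<oplus>\<^bsub>M\<^esub> l a x')"
      using s' t' l_closed r_closed M.M.a_comm by (simp add: D_def mult[OF s t])
    also have "\<dots> = bidual_embed M (r x b') \<oplus>\<^bsub>?DD\<^esub> bidual_embed M (l a x')"
      using s' t' by (intro embed_add l_closed r_closed)
    finally show ?thesis
      using s' t' by (simp add: D_def acts bidual_embed_l bidual_embed_r)
  qed
  have "continuous_map (ntop T) (ntop M) (\<lambda>t. fst (snd t))"
    using A.vnorm_nonneg B.vnorm_nonneg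
    by (intro bounded_linear_map_continuous[where K = 1, OF normed_T M.complex_normed_space_axioms pr]) auto
  moreover have "continuous_map (ntop M) (ntop ?DD) (bidual_embed M)"
    using M.bidual_embed_vnorm_le
    by (intro bounded_linear_map_continuous[where K = 1, OF M.complex_normed_space_axioms
          M''.M.complex_normed_space_axioms M.bidual_embed_linear]) auto
  ultimately have "continuous_map (ntop T) (ntop ?DD) (bidual_embed M \<circ> ((\<lambda>t. fst (snd t)) \<circ> \<sigma>))"
    using cont by (intro continuous_map_compose) (auto simp: continuous_endo_def)
  then have "continuous_map (ntop T) (ntop ?DD) D" by (simp add: D_def o_def)
  moreover have "derivation T ?DD (dual_l (dual M) rD) (dual_r (dual M) lD) \<sigma> \<sigma> D"
    using D_lin D_mult by (simp add: derivation_def)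
  ultimately have "inner_derivation T ?DD (dual_l (dual M) rD) (dual_r (dual M) lD) \<sigma> \<sigma> D"
    using am bim unfolding amenable_def by blast
  then obtain F where F: "F \<in> carrier ?DD"
    "\<And>t. t \<in> carrier T \<Longrightarrow> D t = dual_l (dual M) rD (\<sigma> t) F \<ominus>\<^bsub>?DD\<^esub> dual_r (dual M) lD F (\<sigma> t)"
    unfolding inner_derivation_def by blast
  have cm: "corner A B m \<in> carrier T" using m by (simp add: corner_def)
  have \<sigma>m: "\<sigma> (corner A B m) = corner A B (restrict_M \<sigma> m)"
    using endo_components(2)[OF endo fix_diag _ m] A.M.zero_closed B.M.zero_closed by blast
  have rm: "restrict_M \<sigma> m \<in> carrier M" using closed[OF cm] unfolding \<sigma>m by (simp add: corner_def)
  \<comment> \<open>Both sides act through the diagonal, which vanishes on a corner element.\<close>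
  have "D (corner A B m) = \<zero>\<^bsub>?DD\<^esub> \<ominus>\<^bsub>?DD\<^esub> \<zero>\<^bsub>?DD\<^esub>"
    unfolding F(2)[OF cm] \<sigma>m acts using M''.l_zero_left[OF F(1)] M''.r_zero_right[OF F(1)]
    by (simp add: corner_def)
  also have "\<dots> = \<zero>\<^bsub>?DD\<^esub>" by (simp add: a_minus_def M''.M.M.r_neg)
  finally have "bidual_embed M (restrict_M \<sigma> m) = \<zero>\<^bsub>?DD\<^esub>"
    by (simp add: D_def restrict_M_def)
  then show ?thesis by (rule M.bidual_embed_eq_zero[OF rm])
qed

end

theorem theorem4p5:
  fixes A :: "'a normed_mod" and B :: "'b normed_mod" and M :: "'m normed_mod"
    and l :: "'a \<Rightarrow> 'm \<Rightarrow> 'm" and r :: "'m \<Rightarrow> 'b \<Rightarrow> 'm"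
    and \<sigma> \<tau> :: "'a \<times> 'm \<times> 'b \<Rightarrow> 'a \<times> 'm \<times> 'b"
  assumes "unital_complex_banach_algebra A"
    and "unital_complex_banach_algebra B"
    and "unital_banach_bimodule A B M l r"
    and "continuous_endo (tri A M B l r) \<sigma>" and "idempotent_on (tri A M B l r) \<sigma>"
    and "continuous_endo (tri A M B l r) \<tau>" and "idempotent_on (tri A M B l r) \<tau>"
    and "\<sigma> (diag M \<one>\<^bsub>A\<^esub> \<zero>\<^bsub>B\<^esub>) = diag M \<one>\<^bsub>A\<^esub> \<zero>\<^bsub>B\<^esub>"
    and "\<tau> (diag M \<one>\<^bsub>A\<^esub> \<zero>\<^bsub>B\<^esub>) = diag M \<one>\<^bsub>A\<^esub> \<zero>\<^bsub>B\<^esub>"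
    and "\<sigma> (diag M \<zero>\<^bsub>A\<^esub> \<one>\<^bsub>B\<^esub>) = diag M \<zero>\<^bsub>A\<^esub> \<one>\<^bsub>B\<^esub>"
    and "\<tau> (diag M \<zero>\<^bsub>A\<^esub> \<one>\<^bsub>B\<^esub>) = diag M \<zero>\<^bsub>A\<^esub> \<one>\<^bsub>B\<^esub>"
  shows "(amenable TYPE('e) (tri A M B l r) \<sigma> \<tau> \<longrightarrow>
            amenable TYPE('e) A (restrict_A M B \<sigma>) (restrict_A M B \<tau>) \<and>
            amenable TYPE('e) B (restrict_B A M \<sigma>) (restrict_B A M \<tau>)) \<and>
         (amenable TYPE('m \<Rightarrow> complex) (tri A M B l r) \<sigma> \<sigma> \<longrightarrow>
            \<sigma> ` corner A B ` carrier M = {corner A B \<zero>\<^bsub>M\<^esub>})"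
proof (intro conjI impI)
  interpret unital_banach_bimodule A B M l r by fact
  have fix_diag: "fixes_diagonal \<sigma>" "fixes_diagonal \<tau>" using assms by auto
  show "amenable TYPE('e) A (restrict_A M B \<sigma>) (restrict_A M B \<tau>)"
    and "amenable TYPE('e) B (restrict_B A M \<sigma>) (restrict_B A M \<tau>)"
    if "amenable TYPE('e) T \<sigma> \<tau>"
    using diagonal_amenable[OF that fix_diag] .
  assume am: "amenable TYPE('m \<Rightarrow> complex) T \<sigma> \<sigma>"
  have endo: "algebra_endo T \<sigma>" using assms by (simp add: continuous_endo_def)
  have "\<sigma> (corner A B m) = corner A B \<zero>\<^bsub>M\<^esub>" if "m \<in> carrier M" for m
    using endo_components(2)[OF endo fix_diag(1) A.M.zero_closed that B.M.zero_closed]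
      corner_map_zero[OF am fix_diag(1) that] by simp
  then show "\<sigma> ` corner A B ` carrier M = {corner A B \<zero>\<^bsub>M\<^esub>}"
    using M.M.zero_closed by (auto simp: image_image)
qed

end
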